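(* Let $c\in\{-1,+1\}$, let $f\in C^2(\mathbb{R},\mathbb{R})$ with $f'>0$ on $\mathbb{R}$ and $f(0)=0$, and let $s:\mathbb{R}\to\mathbb{R}$ be $T$-periodic, $T>0$. Let $y_0\in H^1((-1,0),\mathbb{R})$, let $y\in H^1_{loc}((-1,+\infty),\mathbb{R})$ be the solution of $$y'(t)+c\,y'(t-1)+f(y(t))=s(t),\quad t>0,\qquad y(t)=y_0(t),\quad -1<t<0,$$ and let $P$ be a periodic solution of the same equation $P'(t)+c\,P'(t-1)+f(P(t))=s(t)$. Let $I=\mathrm{conv}\bigl(y([-1,+\infty))\cup P(\mathbb{R})\bigr)$ be the convex hull of the two sets. If $I$ is bounded and $$2\,\sup|P'|<\inf_{w\in I,\ d\in P(\mathbb{R})}\frac{\bigl(f(w)-f(d)\bigr)^2}{\bigl|f(w)-f(d)-(w-d)f'(d)\bigr|},$$ then $\displaystyle\lim_{t\to+\infty}\bigl(y(t)-P(t)\bigr)=0$.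
   Context: The equation is a neutral delay differential equation with delay $1$; it is understood to hold for almost every $t$ (derivatives are weak derivatives), and functions in $H^1_{loc}$ are identified with their continuous representatives ($y(-1)$ being the limit of $y_0$ at $-1$). The supremum of $|P'|$ is the (essential) supremum over $\mathbb{R}$. The infimum is taken over the pairs $(w,d)$ for which the denominator is nonzero (it is $+\infty$ if there are none). *)

theory Defs
  imports "HOL-Analysis.Analysis" "HOL-Probability.Essential_Supremum"
begin

definition smooth_fun :: "(real \<Rightarrow> real) \<Rightarrow> bool" where
  "smooth_fun \<phi> \<longleftrightarrow> (\<forall>k x. ((deriv ^^ k) \<phi>) differentiable (at x))"

definition C2_fun :: "(real \<Rightarrow> real) \<Rightarrow> bool" where
  "C2_fun f \<longleftrightarrow> (\<forall>x. f differentiable (at x)) \<and> (\<forall>x. deriv f differentiable (at x))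
     \<and> continuous_on UNIV (deriv (deriv f))"

definition test_fun_on :: "real set \<Rightarrow> (real \<Rightarrow> real) \<Rightarrow> bool" where
  "test_fun_on U \<phi> \<longleftrightarrow> smooth_fun \<phi> \<and> compact (closure {x. \<phi> x \<noteq> 0})
     \<and> closure {x. \<phi> x \<noteq> 0} \<subseteq> U"

definition loc_integrable_on :: "real set \<Rightarrow> (real \<Rightarrow> real) \<Rightarrow> bool" where
  "loc_integrable_on U u \<longleftrightarrow> (\<forall>K. compact K \<and> K \<subseteq> U \<longrightarrow> u absolutely_integrable_on K)"

definition has_weak_deriv_on :: "real set \<Rightarrow> (real \<Rightarrow> real) \<Rightarrow> (real \<Rightarrow> real) \<Rightarrow> bool" where
  "has_weak_deriv_on U u g \<longleftrightarrow> loc_integrable_on U u \<and> loc_integrable_on U g \<and>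
     (\<forall>\<phi>. test_fun_on U \<phi> \<longrightarrow>
        (LINT x:U|lebesgue. u x * deriv \<phi> x) = - (LINT x:U|lebesgue. g x * \<phi> x))"

definition L2_on :: "real set \<Rightarrow> (real \<Rightarrow> real) \<Rightarrow> bool" where
  "L2_on U u \<longleftrightarrow> u \<in> borel_measurable (lebesgue_on U) \<and> (\<lambda>x. (u x)\<^sup>2) absolutely_integrable_on U"

definition L2_loc_on :: "real set \<Rightarrow> (real \<Rightarrow> real) \<Rightarrow> bool" where
  "L2_loc_on U u \<longleftrightarrow> (\<forall>K. compact K \<and> K \<subseteq> U \<longrightarrow> L2_on K u)"

text \<open>The domain \<open>U\<close> is meant to be open; values outside \<open>U\<close> are irrelevant. These predicates do
  not select the continuous representative.\<close>

definition H1_on :: "real set \<Rightarrow> (real \<Rightarrow> real) \<Rightarrow> bool" where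
  "H1_on U u \<longleftrightarrow> L2_on U u \<and> (\<exists>g. has_weak_deriv_on U u g \<and> L2_on U g)"

definition H1_loc_on :: "real set \<Rightarrow> (real \<Rightarrow> real) \<Rightarrow> bool" where
  "H1_loc_on U u \<longleftrightarrow> L2_loc_on U u \<and> (\<exists>g. has_weak_deriv_on U u g \<and> L2_loc_on U g)"

text \<open>Here \<open>u'\<close> is (any representative of) the weak derivative of \<open>u\<close>.\<close>

definition neutral_eq_on ::
    "real set \<Rightarrow> real \<Rightarrow> (real \<Rightarrow> real) \<Rightarrow> (real \<Rightarrow> real) \<Rightarrow> (real \<Rightarrow> real) \<Rightarrow> (real \<Rightarrow> real) \<Rightarrow> bool" where
  "neutral_eq_on J c f s u u' \<longleftrightarrow>
     (AE t in lebesgue. t \<in> J \<longrightarrow> u' t + c * u' (t - 1) + f (u t) = s t)"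

end

theory Submission
  imports Defs
begin

text \<open>
  Let \<open>v = y' - P'\<close>, \<open>g = f(y) - f(P)\<close>, and let \<open>\<Phi>\<close> be an antiderivative of \<open>f\<close>. The convexity gap
  \<open>G = \<Phi>(y) - \<Phi>(P) - f(P) (y - P)\<close> is nonnegative because \<open>f\<close> is increasing. Since \<open>c\<^sup>2 = 1\<close>, the equation
  gives \<open>v(t - 1)\<^sup>2 = (v(t) + g(t))\<^sup>2\<close>, so that the functional \<open>V(t) = \<integral>\<^bsub>t-1\<^esub>\<^bsup>t\<^esup> v\<^sup>2 + 2 G(t)\<close> satisfies
  \<open>V' = - g\<^sup>2 + 2 P' (g - f'(P) (y - P)) \<le> - (1 - \<theta>) g\<^sup>2\<close> for some \<open>\<theta> < 1\<close>, by the hypothesis on \<open>sup \<bar>P'\<bar>\<close>.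
  Hence \<open>g\<^sup>2\<close>, and with it \<open>(y - P)\<^sup>2\<close>, is integrable on the half line, while the bound on
  \<open>\<integral>\<^bsub>t-1\<^esub>\<^bsup>t\<^esup> v\<^sup>2\<close> makes \<open>y - P\<close> uniformly Hoelder continuous; so \<open>y - P\<close> tends to \<open>0\<close>.
\<close>

section \<open>Smooth cutoff functions\<close>

text \<open>For \<open>p = 1\<close> this is the classical smooth function that is flat at 0. The
  polynomial factor in \<open>inverse x\<close> makes the family closed under
  differentiation.\<close>

definition flat_exp :: "real poly \<Rightarrow> real \<Rightarrow> real" where
  "flat_exp p x = (if x > 0 then poly p (inverse x) * exp (- inverse x) else 0)"

text \<open>Every generator has a derivative that is again in the class, so membership yields smoothness
  by rule induction, without Leibniz or Faa di Bruno formulas.\<close>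

inductive flat_smooth :: "(real \<Rightarrow> real) \<Rightarrow> bool" where
  flat_exp: "flat_smooth (flat_exp p)"
| const: "flat_smooth (\<lambda>x. a)"
| add: "flat_smooth f \<Longrightarrow> flat_smooth g \<Longrightarrow> flat_smooth (\<lambda>x. f x + g x)"
| mult: "flat_smooth f \<Longrightarrow> flat_smooth g \<Longrightarrow> flat_smooth (\<lambda>x. f x * g x)"
| affine: "flat_smooth f \<Longrightarrow> flat_smooth (\<lambda>x. f (a * x + b))"
| antideriv: "flat_smooth f \<Longrightarrow> (\<And>x. (F has_real_derivative f x) (at x)) \<Longrightarrow> flat_smooth F"

lemma poly_times_exp_minus_tendsto_0:
  "((\<lambda>y. poly p y * exp (- y)) \<longlongrightarrow> (0::real)) at_top"
proof -
  have "((\<lambda>y. y ^ i * exp (- y)) \<longlongrightarrow> (0::real)) at_top" for i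
    using tendsto_power_div_exp_0[of i] by (simp add: exp_minus divide_inverse)
  then have "((\<lambda>y. \<Sum>i\<le>degree p. coeff p i * (y ^ i * exp (- y))) \<longlongrightarrow> (\<Sum>i\<le>degree p. coeff p i * 0)) at_top"
    by (intro tendsto_sum tendsto_mult tendsto_const)
  then show ?thesis
    by (simp add: poly_altdef sum_distrib_right mult.assoc)
qed

lemma flat_exp_tendsto_0: "(flat_exp p \<longlongrightarrow> 0) (at 0)"
proof -
  have "((\<lambda>x. poly p (inverse x) * exp (- inverse x)) \<longlongrightarrow> (0::real)) (at_right 0)"
    using filterlim_compose[OF poly_times_exp_minus_tendsto_0 filterlim_inverse_at_top_right] .
  moreover have "eventually (\<lambda>x::real. poly p (inverse x) * exp (- inverse x) = flat_exp p x) (at_right 0)"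
    using eventually_at_right_less[of 0] by (rule eventually_mono) (simp add: flat_exp_def)
  ultimately have "(flat_exp p \<longlongrightarrow> 0) (at_right 0)"
    by (rule Lim_transform_eventually)
  moreover have "eventually (\<lambda>x. 0 = flat_exp p x) (at_left 0)"
    by (auto simp: eventually_at_filter flat_exp_def)
  then have "(flat_exp p \<longlongrightarrow> 0) (at_left 0)"
    by (rule Lim_transform_eventually[OF tendsto_const])
  ultimately show ?thesis
    by (simp add: filterlim_split_at_real)
qed

text \<open>For positive \<open>x\<close>, differentiating \<open>poly p (1/x) * exp (-1/x)\<close>
  produces the factor \<open>1/x^2\<close> and replaces \<open>p\<close> by
  \<open>p - pderiv p\<close>. At 0 the limit \<open>flat_exp_tendsto_0\<close> takes over.\<close>

lemma flat_exp_deriv: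
  "(flat_exp p has_real_derivative flat_exp ([:0, 0, 1:] * (p - pderiv p)) x) (at x)"
proof -
  consider "x > 0" | "x < 0" | "x = 0" by linarith
  then show ?thesis
  proof cases
    case 1
    have "((\<lambda>x. poly p (inverse x) * exp (- inverse x)) has_real_derivative
        flat_exp ([:0, 0, 1:] * (p - pderiv p)) x) (at x)"
      using 1 by (auto intro!: derivative_eq_intros DERIV_chain'[where g="poly p"] simp: flat_exp_def power2_eq_square algebra_simps)
    moreover have "eventually (\<lambda>x. poly p (inverse x) * exp (- inverse x) = flat_exp p x) (nhds x)"
      using 1 eventually_nhds_in_open[of "{0<..}" x] by (auto simp: flat_exp_def elim: eventually_mono)
    ultimately show ?thesis by (rule DERIV_cong_ev[OF refl _ refl, THEN iffD1, rotated])
  next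
    case 2
    have "((\<lambda>x. 0) has_real_derivative flat_exp ([:0, 0, 1:] * (p - pderiv p)) x) (at x)"
      using 2 by (auto simp: flat_exp_def)
    moreover have "eventually (\<lambda>x. 0 = flat_exp p x) (nhds x)"
      using 2 eventually_nhds_in_open[of "{..<0}" x] by (auto simp: flat_exp_def elim: eventually_mono)
    ultimately show ?thesis by (rule DERIV_cong_ev[OF refl _ refl, THEN iffD1, rotated])
  next
    case 3
    \<comment> \<open>Dividing by \<open>h\<close> multiplies the polynomial by its variable, so the
      difference quotient at 0 stays in the family. At \<open>h = 0\<close> both sides are 0 because
      division by zero yields 0.\<close>
    have "flat_exp (pCons 0 p) = (\<lambda>h. (flat_exp p (0 + h) - flat_exp p 0) / h)"
      by (auto simp add: flat_exp_def field_simps)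
    with flat_exp_tendsto_0[of "pCons 0 p"]
    have "(flat_exp p has_real_derivative 0) (at 0)"
      unfolding DERIV_def by simp
    then show ?thesis using 3 by (simp add: flat_exp_def)
  qed
qed

lemma flat_smooth_has_deriv:
  assumes "flat_smooth f"
  shows "\<exists>f'. flat_smooth f' \<and> (\<forall>x. (f has_real_derivative f' x) (at x))"
  using assms
proof induction
  case (flat_exp p)
  then show ?case using flat_exp_deriv flat_smooth.flat_exp by blast
next
  case (const a)
  then show ?case using flat_smooth.const[of 0] by (auto intro!: exI[of _ "\<lambda>x. 0"])
next
  case (add f g)
  then obtain f' g' where "flat_smooth f'" "\<And>x. (f has_real_derivative f' x) (at x)"
    "flat_smooth g'" "\<And>x. (g has_real_derivative g' x) (at x)" by blast
  then show ?case
    by (intro exI[of _ "\<lambda>x. f' x + g' x"]) (auto intro: flat_smooth.add DERIV_add)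
next
  case (mult f g)
  then obtain f' g' where "flat_smooth f'" "\<And>x. (f has_real_derivative f' x) (at x)"
    "flat_smooth g'" "\<And>x. (g has_real_derivative g' x) (at x)" by blast
  with mult show ?case
    by (intro exI[of _ "\<lambda>x. f' x * g x + g' x * f x"]) (auto intro!: flat_smooth.add flat_smooth.mult DERIV_mult)
next
  case (affine f a b)
  then obtain f' where f': "flat_smooth f'" "\<And>x. (f has_real_derivative f' x) (at x)" by blast
  have "((\<lambda>x. f (a * x + b)) has_real_derivative f' (a * x + b) * a) (at x)" for x
    by (rule DERIV_chain2[OF f'(2)]) (auto intro!: derivative_eq_intros)
  moreover have "flat_smooth (\<lambda>x. f' (a * x + b) * a)"
    by (rule flat_smooth.mult[OF flat_smooth.affine[OF f'(1)] flat_smooth.const])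
  ultimately show ?case by blast
next
  case (antideriv f F)
  then show ?case by blast
qed

lemma flat_smooth_imp_smooth_fun:
  assumes "flat_smooth f" shows "smooth_fun f"
proof -
  have "flat_smooth ((deriv ^^ k) f)" for k
  proof (induction k)
    case (Suc k)
    then obtain g where g: "flat_smooth g" "\<And>x. ((deriv ^^ k) f has_real_derivative g x) (at x)"
      using flat_smooth_has_deriv by blast
    have "deriv ((deriv ^^ k) f) = g" using g(2) DERIV_imp_deriv by blast
    with g show ?case by simp
  qed (simp add: assms)
  then have "\<exists>D. ((deriv ^^ k) f has_real_derivative D) (at x)" for k x
    using flat_smooth_has_deriv by meson
  then show ?thesis
    unfolding smooth_fun_def real_differentiable_def by simp
qed

text \<open>The step is the normalised antiderivative of a smooth bump on \<open>{0..1}\<close>; the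
  rule \<open>antideriv\<close> places it in the smooth class.\<close>

lemma flat_smooth_step_exists:
  obtains S S' :: "real \<Rightarrow> real"
  where "flat_smooth S" "continuous_on UNIV S'" "\<And>x. (S has_real_derivative S' x) (at x)"
    "\<And>x. S' x \<ge> 0" "\<And>x. x \<le> 0 \<Longrightarrow> S x = 0" "\<And>x. x \<ge> 1 \<Longrightarrow> S x = 1"
    "\<And>x. 0 \<le> S x" "\<And>x. S x \<le> 1" "\<And>x. x \<le> 0 \<or> x \<ge> 1 \<Longrightarrow> S' x = 0"
proof -
  \<comment> \<open>The two factors vanish for \<open>x \<le> 0\<close> and for
    \<open>x \<ge> 1\<close> respectively, so the bump is positive exactly between 0 and 1.\<close>
  define \<beta> where "\<beta> = (\<lambda>x. flat_exp 1 x * flat_exp 1 ((-1) * x + 1))"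
  \<comment> \<open>The lower limit -1 puts every \<open>x \<ge> 0\<close> in the interior of
    \<open>{-1..x+1}\<close>, so that the fundamental theorem gives a two-sided derivative there,
    including at 0.\<close>
  define g where "g x = integral {-1..x} \<beta>" for x
  have \<beta>_smooth: "flat_smooth \<beta>"
    unfolding \<beta>_def by (rule flat_smooth.mult[OF flat_smooth.flat_exp flat_smooth.affine[OF flat_smooth.flat_exp]])
  have \<beta>_cont: "continuous_on UNIV \<beta>"
    using flat_smooth_has_deriv[OF \<beta>_smooth] DERIV_isCont continuous_at_imp_continuous_on by blast
  have \<beta>_0: "\<beta> x = 0" if "x \<le> 0 \<or> x \<ge> 1" for x
    using that by (auto simp: \<beta>_def flat_exp_def)
  have \<beta>_pos: "\<beta> x > 0" if "0 < x" "x < 1" for x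
    using that by (auto simp: \<beta>_def flat_exp_def)
  have \<beta>_nonneg: "\<beta> x \<ge> 0" for x
    by (auto simp: \<beta>_def flat_exp_def)
  have g_0: "g x = 0" if "x \<le> 0" for x
  proof -
    have "integral {-1..x} \<beta> = integral {-1..x} (\<lambda>x. 0)"
      using that by (intro Henstock_Kurzweil_Integration.integral_cong) (auto simp: \<beta>_0)
    then show ?thesis by (simp add: g_def)
  qed
  have g_deriv: "(g has_real_derivative \<beta> x) (at x)" for x
  proof (cases "x < 0")
    case True
    have "((\<lambda>x. 0) has_real_derivative \<beta> x) (at x)"
      using True by (simp add: \<beta>_0)
    moreover have "eventually (\<lambda>x. 0 = g x) (nhds x)"
      using True eventually_nhds_in_open[of "{..<0}" x] by (auto simp: g_0 elim: eventually_mono)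
    ultimately show ?thesis by (rule DERIV_cong_ev[OF refl _ refl, THEN iffD1, rotated])
  next
    case False
    have "((\<lambda>x. integral {-1..x} \<beta>) has_real_derivative \<beta> x) (at x within {-1..x+1})"
      using False by (intro integral_has_real_derivative) (auto intro: continuous_on_subset[OF \<beta>_cont])
    moreover have "x \<in> interior {-1..x+1}" using False by auto
    ultimately show ?thesis
      unfolding g_def using at_within_interior by metis
  qed
  have "g 0 < g 1"
    using g_deriv \<beta>_pos
    by (intro DERIV_pos_imp_increasing_open[of 0 1 g]) 
      (auto intro!: DERIV_continuous_on intro: has_field_derivative_at_within)
  then have g_1: "g 1 > 0" by (simp add: g_0)
  have mono: "g x \<le> g y" if "x \<le> y" for x y
    using that g_deriv \<beta>_nonneg DERIV_nonneg_imp_nondecreasing by metis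
  have g_ge: "g x = g 1" if "x \<ge> 1" for x
  proof (cases "x = 1")
    case False
    with that have "x > 1" by simp
    then show ?thesis
      by (intro DERIV_isconst_end[of 1 x g])
        (auto intro!: DERIV_continuous_on has_field_derivative_at_within[OF g_deriv]
          simp: g_deriv \<beta>_0 intro: DERIV_cong[OF g_deriv])
  qed simp
  show ?thesis
  proof (rule that[of "\<lambda>x. inverse (g 1) * g x" "\<lambda>x. inverse (g 1) * \<beta> x"])
    show "flat_smooth (\<lambda>x. inverse (g 1) * g x)"
      using flat_smooth.antideriv[OF \<beta>_smooth g_deriv] by (rule flat_smooth.mult[OF flat_smooth.const])
    show "((\<lambda>x. inverse (g 1) * g x) has_real_derivative inverse (g 1) * \<beta> x) (at x)" for x
      by (intro DERIV_cmult g_deriv)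
    show "continuous_on UNIV (\<lambda>x. inverse (g 1) * \<beta> x)"
      by (intro continuous_intros \<beta>_cont)
    fix x
    show "0 \<le> inverse (g 1) * \<beta> x" using g_1 \<beta>_nonneg by simp
    show "x \<le> 0 \<or> x \<ge> 1 \<Longrightarrow> inverse (g 1) * \<beta> x = 0" by (simp add: \<beta>_0)
    show "x \<le> 0 \<Longrightarrow> inverse (g 1) * g x = 0" by (simp add: g_0)
    show "x \<ge> 1 \<Longrightarrow> inverse (g 1) * g x = 1" using g_1 g_ge[of x] by simp
    have "0 \<le> g x" "g x \<le> g 1"
      using mono[of x 1] mono[of 0 x] g_ge[of x] g_0[of x] g_0[of 0] g_1 by linarith+
    then show "0 \<le> inverse (g 1) * g x" "inverse (g 1) * g x \<le> 1"
      using g_1 by (auto simp: field_simps)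
  qed
qed

section \<open>Weak derivatives on the line\<close>

lemma absolutely_integrable_continuous_mult:
  fixes g h :: "real \<Rightarrow> real"
  assumes "continuous_on {a..b} h" "g absolutely_integrable_on {a..b}"
  shows "(\<lambda>x. h x * g x) absolutely_integrable_on {a..b}"
proof (rule absolutely_integrable_bounded_measurable_product_real)
  show "h \<in> borel_measurable (lebesgue_on {a..b})"
    using assms(1) by (intro continuous_imp_measurable_on_sets_lebesgue) auto
  show "bounded (h ` {a..b})"
    using assms(1) by (intro compact_imp_bounded compact_continuous_image) auto
qed (use assms in auto)

lemma set_lebesgue_integral_eq_integral_support:
  fixes h :: "real \<Rightarrow> real"
  assumes "{a..d} \<subseteq> U" "\<And>x. x \<notin> {a..d} \<Longrightarrow> h x = 0" "h absolutely_integrable_on {a..d}"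
  shows "(LINT x:U|lebesgue. h x) = integral {a..d} h"
proof -
  have "(LINT x:U|lebesgue. h x) = (LINT x:{a..d}|lebesgue. h x)"
    unfolding set_lebesgue_integral_def using assms(1,2)
    by (intro Bochner_Integration.integral_cong) (auto simp: indicator_def)
  then show ?thesis
    using set_lebesgue_integral_eq_integral(2)[OF assms(3)] by simp
qed

text \<open>The weights form a one-sided approximate identity: they are nonnegative, vanish outside
  \<open>{c..c + 1 / k n}\<close> and have mass 1 on \<open>{a..d}\<close>. Hence they average the
  continuous \<open>u\<close> to its value at \<open>c\<close>.\<close>

lemma concentrating_weight_integral_tendsto:
  fixes u S S' :: "real \<Rightarrow> real" and k :: "nat \<Rightarrow> real"
  assumes u: "continuous_on {a..d} u" and S': "continuous_on UNIV S'" "\<And>x. (S has_real_derivative S' x) (at x)"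
    and S'_pos: "\<And>x. S' x \<ge> 0" and S'_0: "\<And>x. x \<le> 0 \<or> x \<ge> 1 \<Longrightarrow> S' x = 0"
    and S: "\<And>x. x \<le> 0 \<Longrightarrow> S x = 0" "\<And>x. x \<ge> 1 \<Longrightarrow> S x = 1"
    and c: "a \<le> c" "\<And>n. c + 1 / k n \<le> d" and k: "\<And>n. k n > 0" "filterlim k at_top sequentially"
  shows "(\<lambda>n. integral {a..d} (\<lambda>x. u x * (k n * S' (k n * x + - k n * c)))) \<longlonglongrightarrow> u c"
proof (rule LIMSEQ_I)
  fix e :: real assume e: "0 < e"
  have "c \<in> {a..d}" using c k(1)[of 0] by (auto intro: order.trans[OF _ c(2)[of 0]])
  with u e obtain \<eta> where \<eta>: "\<eta> > 0" "\<And>x. x \<in> {a..d} \<Longrightarrow> \<bar>x - c\<bar> < \<eta> \<Longrightarrow> \<bar>u x - u c\<bar> < e / 2"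
    unfolding continuous_on_iff dist_real_def by (meson half_gt_zero)
  \<comment> \<open>From then on the support of the weight is shorter than \<open>\<eta>\<close>, so
    only values of \<open>u\<close> within \<open>e / 2\<close> of \<open>u c\<close> count.\<close>
  have "eventually (\<lambda>n. k n > 1 / \<eta>) sequentially"
    using k(2) by (simp add: filterlim_at_top_dense)
  then obtain N where N: "\<And>n. n \<ge> N \<Longrightarrow> k n > 1 / \<eta>" by (auto simp: eventually_sequentially)
  have "norm (integral {a..d} (\<lambda>x. u x * (k n * S' (k n * x + - k n * c))) - u c) < e" if n: "n \<ge> N" for n
  proof -
    define \<psi> where "\<psi> x = k n * S' (k n * x + - k n * c)" for x
    have \<psi>_cont: "continuous_on A \<psi>" for A
      unfolding \<psi>_def by (intro continuous_intros continuous_on_compose2[OF S'(1)]) auto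
    have \<psi>_pos: "\<psi> x \<ge> 0" for x
      using k(1)[of n] S'_pos unfolding \<psi>_def by simp
    have ad: "a \<le> d" using \<open>c \<in> {a..d}\<close> by auto
    have deriv: "((\<lambda>x. S (k n * x + - k n * c)) has_real_derivative \<psi> x) (at x)" for x
      unfolding \<psi>_def
      by (rule DERIV_cong[OF DERIV_chain2[OF S'(2)]]) (auto intro!: derivative_eq_intros)
    have "(\<psi> has_integral S (k n * d + - k n * c) - S (k n * a + - k n * c)) {a..d}"
      using ad deriv
      by (intro fundamental_theorem_of_calculus)
        (auto simp: has_real_derivative_iff_has_vector_derivative[symmetric] intro: has_field_derivative_at_within)
    moreover have "S (k n * a + - k n * c) = 0"
      using c(1) k(1)[of n] by (intro S(1)) (simp add: algebra_simps)
    moreover have "S (k n * d + - k n * c) = 1"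
      using c(2)[of n] k(1)[of n] by (intro S(2)) (simp add: field_simps)
    ultimately have \<psi>_int: "(\<psi> has_integral 1) {a..d}" by simp
    have u\<psi>: "(\<lambda>x. u x * \<psi> x) integrable_on {a..d}"
      by (intro integrable_continuous_real continuous_intros u \<psi>_cont)
    have "integral {a..d} (\<lambda>x. u x * \<psi> x) - u c = integral {a..d} (\<lambda>x. u x * \<psi> x - u c * \<psi> x)"
      using integral_unique[OF has_integral_diff[OF integrable_integral[OF u\<psi>] has_integral_mult_right[OF \<psi>_int, of "u c"]]]
      by simp
    also have "norm \<dots> \<le> integral {a..d} (\<lambda>x. e / 2 * \<psi> x)"
    proof (rule Henstock_Kurzweil_Integration.integral_norm_bound_integral)
      show "(\<lambda>x. u x * \<psi> x - u c * \<psi> x) integrable_on {a..d}" "(\<lambda>x. e / 2 * \<psi> x) integrable_on {a..d}"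
        by (intro integrable_continuous_real continuous_intros u \<psi>_cont)+
      fix x assume x: "x \<in> {a..d}"
      show "norm (u x * \<psi> x - u c * \<psi> x) \<le> e / 2 * \<psi> x"
      proof (cases "\<bar>x - c\<bar> < \<eta>")
        case True
        then have "\<bar>u x - u c\<bar> * \<psi> x \<le> e / 2 * \<psi> x"
          using \<eta>(2)[OF x] \<psi>_pos[of x] by (intro mult_right_mono) auto
        moreover have "\<bar>u x * \<psi> x - u c * \<psi> x\<bar> = \<bar>u x - u c\<bar> * \<psi> x"
          using \<psi>_pos[of x] by (simp add: abs_mult flip: left_diff_distrib)
        ultimately show ?thesis by simp
      next
        case False
        have "1 < k n * \<eta>" using N[OF n] \<eta>(1) by (simp add: field_simps)
        also have "\<dots> \<le> k n * \<bar>x - c\<bar>" using False k(1)[of n] by simp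
        finally have "1 < k n * \<bar>x - c\<bar>" .
        then have "k n * x + - k n * c \<le> 0 \<or> k n * x + - k n * c \<ge> 1"
          by (cases "x \<ge> c") (auto simp: algebra_simps abs_if split: if_splits)
        then show ?thesis using S'_0 by (simp add: \<psi>_def)
      qed
    qed
    also have "\<dots> = e / 2" using \<psi>_int by (simp add: integral_unique)
    finally show ?thesis using e unfolding \<psi>_def by simp
  qed
  then show "\<exists>no. \<forall>n\<ge>no. norm (integral {a..d} (\<lambda>x. u x * (k n * S' (k n * x + - k n * c))) - u c) < e"
    by blast
qed

text \<open>Test with smooth approximations of the indicator of \<open>{a<..b}\<close>, whose derivatives
  concentrate at the end points.\<close>

lemma has_weak_deriv_on_imp_integral:
  assumes U: "open U" "{a..b} \<subseteq> U" "a \<le> b"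
    and u: "continuous_on U u" "has_weak_deriv_on U u g"
  shows "u b - u a = integral {a..b} g"
proof -
  obtain S S' :: "real \<Rightarrow> real" where S: "flat_smooth S"
    and S'1: "continuous_on UNIV S'" "\<And>x. (S has_real_derivative S' x) (at x)" "\<And>x. S' x \<ge> 0"
    and S_val: "\<And>x. x \<le> 0 \<Longrightarrow> S x = 0" "\<And>x. x \<ge> 1 \<Longrightarrow> S x = 1" "\<And>x. 0 \<le> S x" "\<And>x. S x \<le> 1"
    and S'0: "\<And>x. x \<le> 0 \<or> x \<ge> 1 \<Longrightarrow> S' x = 0"
    by (rule flat_smooth_step_exists, rule that) assumption+
  note S' = S'1 S'0
  have "b \<in> U" using U by auto
  with U(1) obtain \<delta> where \<delta>: "\<delta> > 0" "cball b \<delta> \<subseteq> U"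
    using open_contains_cball by blast
  \<comment> \<open>The cutoffs fall from 1 to 0 just to the right of \<open>b\<close>; the margin
    \<open>\<delta>\<close> keeps their supports inside \<open>U\<close>.\<close>
  define d where "d = b + \<delta>"
  have adU: "{a..d} \<subseteq> U"
  proof
    fix x assume "x \<in> {a..d}"
    then show "x \<in> U"
      using U(2) \<delta>(2) by (cases "x \<le> b") (auto simp: d_def subset_iff dist_real_def)
  qed
  \<comment> \<open>The offset \<open>1 / \<delta>\<close> makes each transition at most
    \<open>\<delta>\<close> long, already at \<open>n = 0\<close>.\<close>
  define k where "k n = 1 / \<delta> + real n" for n
  have k_pos: "k n > 0" for n using \<delta>(1) by (simp add: k_def add_pos_nonneg)
  have "1 / k n \<le> 1 / (1 / \<delta>)" for n
    using \<delta>(1) by (intro divide_left_mono) (auto simp: k_def add_pos_nonneg)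
  then have k_le: "1 / k n \<le> \<delta>" for n by simp
  have k_lim: "filterlim k at_top sequentially"
    unfolding k_def by (rule filterlim_tendsto_add_at_top[OF tendsto_const filterlim_real_sequentially])
  \<comment> \<open>A rise starting at \<open>a\<close> minus a rise starting at \<open>b\<close>.
    Both steps vanish at their starting points, so the pointwise limit is the indicator of
    \<open>{a<..b}\<close>. The difference is written as a sum to match the generators of
    \<open>flat_smooth\<close>.\<close>
  define \<phi> where "\<phi> n x = S (k n * x + - k n * a) + (-1) * S (k n * x + - k n * b)" for n x
  define \<phi>' where "\<phi>' n x = k n * S' (k n * x + - k n * a) - k n * S' (k n * x + - k n * b)" for n x
  have \<phi>_deriv: "(\<phi> n has_real_derivative \<phi>' n x) (at x)" for n x
  proof -
    have "((\<lambda>x. S (k n * x + - k n * c)) has_real_derivative k n * S' (k n * x + - k n * c)) (at x)" for c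
      by (rule DERIV_cong[OF DERIV_chain2[OF S'(2)]]) (auto intro!: derivative_eq_intros)
    note D = this
    show ?thesis unfolding \<phi>_def \<phi>'_def
      by (rule DERIV_cong[OF DERIV_add[OF D DERIV_cmult[OF D]]]) simp
  qed
  have \<phi>_cont: "continuous_on A (\<phi> n)" for n A
    using \<phi>_deriv DERIV_isCont continuous_at_imp_continuous_on by blast
  have \<phi>'_cont: "continuous_on A (\<phi>' n)" for n A
    unfolding \<phi>'_def by (intro continuous_intros continuous_on_compose2[OF S'(1)]) auto
  have \<phi>_smooth: "smooth_fun (\<phi> n)" for n
  proof -
    have "flat_smooth (\<phi> n)"
      unfolding \<phi>_def
      by (rule flat_smooth.add[OF flat_smooth.affine[OF S] flat_smooth.mult[OF flat_smooth.const flat_smooth.affine[OF S]]])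
    then show ?thesis by (rule flat_smooth_imp_smooth_fun)
  qed
  have arg_le: "k n * x + - k n * c \<le> 0" if "x \<le> c" for n x c
    using that k_pos[of n] by (simp add: algebra_simps)
  have arg_ge: "k n * x + - k n * c \<ge> 1" if "x \<ge> c + \<delta>" for n x c
  proof -
    have "c + 1 / k n \<le> x" using k_le[of n] that by linarith
    then show ?thesis using k_pos[of n] by (simp add: field_simps)
  qed
  have \<phi>_0: "\<phi> n x = 0" "\<phi>' n x = 0" if "x \<notin> {a..d}" for n x
  proof -
    consider "x \<le> a" "x \<le> b" | "x \<ge> a + \<delta>" "x \<ge> b + \<delta>"
      using \<open>x \<notin> {a..d}\<close> U(3) by (force simp: d_def)
    then have "\<phi> n x = 0 \<and> \<phi>' n x = 0"
    proof cases
      case 1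
      show ?thesis
        unfolding \<phi>_def \<phi>'_def S_val(1)[OF arg_le[OF 1(1)]] S_val(1)[OF arg_le[OF 1(2)]]
          S'0[OF disjI1[OF arg_le[OF 1(1)]]] S'0[OF disjI1[OF arg_le[OF 1(2)]]] by simp
    next
      case 2
      show ?thesis
        unfolding \<phi>_def \<phi>'_def S_val(2)[OF arg_ge[OF 2(1)]] S_val(2)[OF arg_ge[OF 2(2)]]
          S'0[OF disjI2[OF arg_ge[OF 2(1)]]] S'0[OF disjI2[OF arg_ge[OF 2(2)]]] by simp
    qed
    then show "\<phi> n x = 0" "\<phi>' n x = 0" by auto
  qed
  have \<phi>_bound: "\<bar>\<phi> n x\<bar> \<le> 1" for n x
    unfolding \<phi>_def using S_val(3)[of "k n * x + - k n * a"] S_val(3)[of "k n * x + - k n * b"]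
      S_val(4)[of "k n * x + - k n * a"] S_val(4)[of "k n * x + - k n * b"] by linarith
  have test: "test_fun_on U (\<phi> n)" for n
  proof -
    have sub: "closure {x. \<phi> n x \<noteq> 0} \<subseteq> {a..d}"
      by (rule closure_minimal) (use \<phi>_0(1) in blast, simp)
    moreover have "compact (closure {x. \<phi> n x \<noteq> 0})"
      using sub by (metis closed_closure compact_Icc compact_Int_closed inf.absorb_iff2)
    ultimately show ?thesis
      unfolding test_fun_on_def using adU \<phi>_smooth by blast
  qed
  have g_int: "g absolutely_integrable_on {a..d}"
    using u(2) adU unfolding has_weak_deriv_on_def loc_integrable_on_def by auto
  have u_cont: "continuous_on {a..d} u" using u(1) adU continuous_on_subset by blast
  have weak: "integral {a..d} (\<lambda>x. u x * \<phi>' n x) = - integral {a..d} (\<lambda>x. g x * \<phi> n x)" for n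
  proof -
    have "deriv (\<phi> n) = \<phi>' n" using \<phi>_deriv DERIV_imp_deriv by blast
    then have "(LINT x:U|lebesgue. u x * \<phi>' n x) = - (LINT x:U|lebesgue. g x * \<phi> n x)"
      using u(2) test[of n] unfolding has_weak_deriv_on_def by metis
    moreover have "(LINT x:U|lebesgue. u x * \<phi>' n x) = integral {a..d} (\<lambda>x. u x * \<phi>' n x)"
      by (intro set_lebesgue_integral_eq_integral_support adU absolutely_integrable_continuous_real
          continuous_intros u_cont \<phi>'_cont) (simp add: \<phi>_0)
    moreover have "(LINT x:U|lebesgue. g x * \<phi> n x) = integral {a..d} (\<lambda>x. g x * \<phi> n x)"
      using absolutely_integrable_continuous_mult[OF \<phi>_cont g_int]
      by (intro set_lebesgue_integral_eq_integral_support adU) (auto simp add: \<phi>_0 mult.commute)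
    ultimately show ?thesis by simp
  qed
  have lim_u: "(\<lambda>n. integral {a..d} (\<lambda>x. u x * \<phi>' n x)) \<longlonglongrightarrow> u a - u b"
  proof -
    have conv: "(\<lambda>n. integral {a..d} (\<lambda>x. u x * (k n * S' (k n * x + - k n * c)))) \<longlonglongrightarrow> u c"
      if c: "a \<le> c" "c \<le> b" for c
    proof (rule concentrating_weight_integral_tendsto[OF u_cont S' S_val(1,2) c(1) _ k_pos k_lim])
      show "c + 1 / k n \<le> d" for n using k_le[of n] c(2) by (simp add: d_def)
    qed
    have split: "integral {a..d} (\<lambda>x. u x * (k n * S' (k n * x + - k n * a)))
        - integral {a..d} (\<lambda>x. u x * (k n * S' (k n * x + - k n * b)))
      = integral {a..d} (\<lambda>x. u x * \<phi>' n x)" for n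
    proof -
      have "(\<lambda>x. u x * (k n * S' (k n * x + - k n * c))) integrable_on {a..d}" for c
        by (intro integrable_continuous_real continuous_intros u_cont continuous_on_compose2[OF S'(1)]) auto
      then show ?thesis
        unfolding \<phi>'_def right_diff_distrib
        by (intro Henstock_Kurzweil_Integration.integral_diff[symmetric])
    qed
    from tendsto_diff[OF conv conv, of a b] U(3) show ?thesis by (simp only: split order_refl)
  qed
  have lim_g: "(\<lambda>n. integral {a..d} (\<lambda>x. g x * \<phi> n x)) \<longlonglongrightarrow> integral {a..d} (\<lambda>x. if x \<in> {a<..b} then g x else 0)"
  proof (rule dominated_convergence(2))
    show "(\<lambda>x. g x * \<phi> n x) integrable_on {a..d}" for n
      using absolutely_integrable_continuous_mult[OF \<phi>_cont g_int]
      by (simp add: mult.commute set_lebesgue_integral_eq_integral(1))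
    show "(\<lambda>x. \<bar>g x\<bar>) integrable_on {a..d}"
      using g_int unfolding absolutely_integrable_on_def by simp
    show "norm (g x * \<phi> n x) \<le> \<bar>g x\<bar>" for n x
      using mult_left_mono[OF \<phi>_bound[of n x], of "\<bar>g x\<bar>"] by (simp add: abs_mult)
    fix x
    have ev: "eventually (\<lambda>n. S (k n * x + - k n * c) = 1) sequentially" if "x > c" for c
    proof -
      have "eventually (\<lambda>n. k n > 1 / (x - c)) sequentially"
        using k_lim by (simp add: filterlim_at_top_dense)
      then show ?thesis
        by eventually_elim (rule S_val(2), use that in \<open>simp add: field_simps\<close>)
    qed
    have ev0: "eventually (\<lambda>n. S (k n * x + - k n * c) = 0) sequentially" if "x \<le> c" for c
      using S_val(1)[OF arg_le[OF that]] by simp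
    have "eventually (\<lambda>n. g x * \<phi> n x = (if x \<in> {a<..b} then g x else 0)) sequentially"
    proof -
      consider "x \<le> a" "x \<le> b" | "x > a" "x \<le> b" | "x > a" "x > b" using U(3) by linarith
      then show ?thesis
      proof cases
        case 1
        from ev0[OF 1(1)] ev0[OF 1(2)] show ?thesis
          by eventually_elim (use 1 in \<open>simp only: \<phi>_def, simp\<close>)
      next
        case 2
        from ev[OF 2(1)] ev0[OF 2(2)] show ?thesis
          by eventually_elim (use 2 in \<open>simp only: \<phi>_def, simp\<close>)
      next
        case 3
        from ev[OF 3(1)] ev[OF 3(2)] show ?thesis
          by eventually_elim (use 3 in \<open>simp only: \<phi>_def, simp\<close>)
      qed
    qed
    then show "(\<lambda>n. g x * \<phi> n x) \<longlonglongrightarrow> (if x \<in> {a<..b} then g x else 0)"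
      by (rule tendsto_eventually)
  qed
  \<comment> \<open>Both sides of the weak formulation pass to the limit: the left one by
    concentration at the end points, the right one by dominated convergence with majorant
    \<open>\<bar>g x\<bar>\<close>.\<close>
  have "u a - u b = - integral {a..d} (\<lambda>x. if x \<in> {a<..b} then g x else 0)"
    using LIMSEQ_unique[OF lim_u[unfolded weak] tendsto_minus[OF lim_g]] .
  also have "integral {a..d} (\<lambda>x. if x \<in> {a<..b} then g x else 0) = integral ({a<..b} \<inter> {a..d}) g"
    by (rule Henstock_Kurzweil_Integration.integral_restrict_Int)
  also have "{a<..b} \<inter> {a..d} = {a<..b}" using \<delta>(1) by (auto simp: d_def)
  also have "integral {a<..b} g = integral {a..b} g"
    by (rule integral_spike_set) (rule negligible_subset[of "{a}"], auto)+
  finally show ?thesis by simp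
qed

text \<open>Lebesgue differentiation: the difference, cut off to a compact interval, has integral 0
  over every interval, and almost everywhere it is the limit of its averages. Countably many such
  intervals exhaust \<open>U\<close>.\<close>

lemma AE_eq_on_open_if_integrals_eq:
  fixes g h :: "real \<Rightarrow> real"
  assumes "open U"
    and int: "\<And>a b. {a..b} \<subseteq> U \<Longrightarrow> g integrable_on {a..b}" "\<And>a b. {a..b} \<subseteq> U \<Longrightarrow> h integrable_on {a..b}"
    and eq: "\<And>a b. a \<le> b \<Longrightarrow> {a..b} \<subseteq> U \<Longrightarrow> integral {a..b} g = integral {a..b} h"
  shows "AE x in lebesgue. x \<in> U \<longrightarrow> g x = h x"
proof -
  have AE_Icc: "AE x in lebesgue. x \<in> {a..b} \<longrightarrow> g x = h x" if ab: "{a..b} \<subseteq> U" for a b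
  proof -
    define D where "D x = (if x \<in> {a..b} then g x - h x else 0)" for x
    have sub: "{a..b} \<inter> {p..q} = {max a p..min b q}" for p q by auto
    have D_int: "D integrable_on cbox p q" for p q
    proof -
      have "(\<lambda>x. g x - h x) integrable_on {a..b} \<inter> cbox p q"
        using ab int[of "max a p" "min b q"] sub[of p q]
        by (simp add: Henstock_Kurzweil_Integration.integrable_diff subset_iff)
      then show ?thesis unfolding D_def by (simp only: Henstock_Kurzweil_Integration.integrable_restrict_Int)
    qed
    have D_0: "integral (cbox p q) D = 0" for p q
    proof -
      have "integral (cbox p q) D = integral ({a..b} \<inter> cbox p q) (\<lambda>x. g x - h x)"
        unfolding D_def by (rule Henstock_Kurzweil_Integration.integral_restrict_Int)
      also have "\<dots> = integral {max a p..min b q} (\<lambda>x. g x - h x)"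
        using sub[of p q] by simp
      also have "\<dots> = 0"
      proof (cases "max a p \<le> min b q")
        case True
        have "{max a p..min b q} \<subseteq> U" using ab by auto
        then show ?thesis
          using int eq[OF True] by (subst Henstock_Kurzweil_Integration.integral_diff) auto
      qed simp
      finally show ?thesis .
    qed
    \<comment> \<open>Outside \<open>N\<close> the averages over \<open>{x..x + r}\<close> converge
      to \<open>D x\<close>; as all of them are 0, so is \<open>D x\<close>.\<close>
    obtain N where N: "negligible N" "\<And>x e. \<lbrakk>x \<notin> N; 0 < e\<rbrakk> \<Longrightarrow> \<exists>\<delta>>0. \<forall>r. 0 < r \<and> r < \<delta> \<longrightarrow>
          norm (integral (cbox x (x + r *\<^sub>R One)) D /\<^sub>R r ^ DIM(real) - D x) < e"
      using integrable_ccontinuous_explicit[of D] D_int by blast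
    have "D x = 0" if xN: "x \<notin> N" for x
    proof (rule ccontr)
      assume "D x \<noteq> 0"
      then obtain \<delta> where \<delta>: "\<delta> > 0" "\<And>r. 0 < r \<Longrightarrow> r < \<delta> \<Longrightarrow>
          norm (integral (cbox x (x + r *\<^sub>R One)) D /\<^sub>R r ^ DIM(real) - D x) < \<bar>D x\<bar>"
        using N(2)[OF xN, of "\<bar>D x\<bar>"] by auto
      from \<delta>(2)[of "\<delta> / 2"] \<delta>(1) show False unfolding D_0 by simp
    qed
    then have "{x \<in> space lebesgue. \<not> (x \<in> {a..b} \<longrightarrow> g x = h x)} \<subseteq> N"
      by (force simp: D_def)
    with N(1) show ?thesis
      by (intro AE_I'[of N]) (auto simp: negligible_iff_null_sets)
  qed
  obtain \<D> where \<D>: "countable \<D>" "\<D> \<subseteq> Pow U" "\<And>X. X \<in> \<D> \<Longrightarrow> \<exists>a b. X = cbox a b" "\<Union>\<D> = U"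
    using open_countable_Union_open_cbox[OF \<open>open U\<close>] by metis
  have "AE x in lebesgue. \<forall>X\<in>\<D>. x \<in> X \<longrightarrow> g x = h x"
  proof (subst AE_ball_countable[OF \<D>(1)], intro ballI)
    fix X assume X: "X \<in> \<D>"
    with \<D>(3) obtain a b where "X = {a..b}" by force
    with AE_Icc X \<D>(2) show "AE x in lebesgue. x \<in> X \<longrightarrow> g x = h x" by blast
  qed
  then show ?thesis
    by eventually_elim (use \<D>(4) in blast)
qed

section \<open>Calculus in the Sobolev space of order one\<close>

text \<open>The functions of \<open>H\<^sup>1(a, b)\<close>, given by their continuous representative \<open>u\<close> and a weak derivative \<open>v\<close>.\<close>

definition H1_primitive :: "real \<Rightarrow> real \<Rightarrow> (real \<Rightarrow> real) \<Rightarrow> (real \<Rightarrow> real) \<Rightarrow> bool" where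
  "H1_primitive a b u v \<longleftrightarrow> v absolutely_integrable_on {a..b} \<and> (\<lambda>x. (v x)\<^sup>2) integrable_on {a..b} \<and>
     (\<forall>s t. a \<le> s \<longrightarrow> s \<le> t \<longrightarrow> t \<le> b \<longrightarrow> u t - u s = integral {s..t} v)"

text \<open>Cauchy-Schwarz against the constant 1, obtained by integrating
  \<open>(v x - m)^2 \<ge> 0\<close> with \<open>m\<close> the mean of \<open>v\<close>.\<close>

lemma integral_squared_le:
  fixes v :: "real \<Rightarrow> real"
  assumes "s \<le> t" and v: "v integrable_on {s..t}" "(\<lambda>x. (v x)\<^sup>2) integrable_on {s..t}"
  shows "(integral {s..t} v)\<^sup>2 \<le> (t - s) * integral {s..t} (\<lambda>x. (v x)\<^sup>2)"
proof (cases "s = t")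
  case False
  define m where "m = integral {s..t} v / (t - s)"
  have m: "integral {s..t} v = m * (t - s)" using False by (simp add: m_def)
  have "((\<lambda>x. (v x)\<^sup>2 - 2 * m * v x + m\<^sup>2) has_integral
      integral {s..t} (\<lambda>x. (v x)\<^sup>2) - 2 * m * integral {s..t} v + (t - s) *\<^sub>R m\<^sup>2) {s..t}"
    using has_integral_const_real[of "m\<^sup>2" s t] assms
    by (intro has_integral_add has_integral_diff has_integral_mult_right integrable_integral) auto
  moreover have "0 \<le> (v x)\<^sup>2 - 2 * m * v x + m\<^sup>2" for x
    using zero_le_power2[of "v x - m"] by (simp add: power2_diff mult_ac)
  ultimately have "0 \<le> integral {s..t} (\<lambda>x. (v x)\<^sup>2) - 2 * m * integral {s..t} v + (t - s) *\<^sub>R m\<^sup>2"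
    by (rule has_integral_nonneg)
  then have "m\<^sup>2 * (t - s) \<le> integral {s..t} (\<lambda>x. (v x)\<^sup>2)"
    by (simp add: m power2_eq_square algebra_simps)
  then have "(t - s) * (m\<^sup>2 * (t - s)) \<le> (t - s) * integral {s..t} (\<lambda>x. (v x)\<^sup>2)"
    using assms(1) by (intro mult_left_mono) auto
  then show ?thesis by (simp add: m power2_eq_square algebra_simps)
qed simp

lemma square_integrable_mult:
  fixes v w :: "real \<Rightarrow> real"
  assumes "v integrable_on {a..b}" "(\<lambda>x. (v x)\<^sup>2) integrable_on {a..b}"
    and "w integrable_on {a..b}" "(\<lambda>x. (w x)\<^sup>2) integrable_on {a..b}"
  shows "(\<lambda>x. v x * w x) absolutely_integrable_on {a..b}"
proof (rule measurable_bounded_by_integrable_imp_absolutely_integrable)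
  show "(\<lambda>x. v x * w x) \<in> borel_measurable (lebesgue_on {a..b})"
    using assms by (intro borel_measurable_times integrable_imp_measurable)
  show "(\<lambda>x. (v x)\<^sup>2 + (w x)\<^sup>2) integrable_on {a..b}"
    using assms by (intro Henstock_Kurzweil_Integration.integrable_add)
  show "norm (v x * w x) \<le> (v x)\<^sup>2 + (w x)\<^sup>2" for x
  proof -
    have "0 \<le> (\<bar>v x\<bar> - \<bar>w x\<bar>)\<^sup>2" "0 \<le> \<bar>v x\<bar> * \<bar>w x\<bar>" by auto
    then have "\<bar>v x\<bar> * \<bar>w x\<bar> \<le> \<bar>v x\<bar>\<^sup>2 + \<bar>w x\<bar>\<^sup>2" by (simp only: power2_diff)
    then show ?thesis by (simp add: abs_mult)
  qed
qed auto

lemma H1_primitive_continuous: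
  assumes "H1_primitive a b u v" shows "continuous_on {a..b} u"
proof -
  have "continuous_on {a..b} (\<lambda>t. u a + integral {a..t} v)"
    using assms unfolding H1_primitive_def
    by (intro continuous_intros indefinite_integral_continuous_1 set_lebesgue_integral_eq_integral(1)) auto
  moreover have "u a + integral {a..x} v = u x" if "x \<in> {a..b}" for x
  proof -
    have "u x - u a = integral {a..x} v" using assms that unfolding H1_primitive_def by auto
    then show ?thesis by simp
  qed
  ultimately show ?thesis by (rule continuous_on_eq)
qed

lemma H1_primitive_integrable:
  assumes "H1_primitive a b u v" "{s..t} \<subseteq> {a..b}"
  shows "v absolutely_integrable_on {s..t}" "v integrable_on {s..t}" "(\<lambda>x. \<bar>v x\<bar>) integrable_on {s..t}"
    "(\<lambda>x. (v x)\<^sup>2) integrable_on {s..t}"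
proof -
  show "v absolutely_integrable_on {s..t}"
    using assms unfolding H1_primitive_def by (metis set_integrable_subset lmeasurable_interval(2) fmeasurableD lmeasurable_cbox cbox_interval)
  then show "v integrable_on {s..t}" "(\<lambda>x. \<bar>v x\<bar>) integrable_on {s..t}"
    unfolding absolutely_integrable_on_def by auto
  show "(\<lambda>x. (v x)\<^sup>2) integrable_on {s..t}"
    using assms integrable_subinterval_real unfolding H1_primitive_def by blast
qed

lemma H1_primitive_add:
  assumes "H1_primitive a b u v" "H1_primitive a b u' v'"
  shows "H1_primitive a b (\<lambda>x. u x + u' x) (\<lambda>x. v x + v' x)"
  unfolding H1_primitive_def
proof (intro conjI allI impI)
  note int = H1_primitive_integrable[OF assms(1)] H1_primitive_integrable[OF assms(2)]
  show "(\<lambda>x. v x + v' x) absolutely_integrable_on {a..b}"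
    by (intro set_integral_add(1) int order_refl)
  have "(\<lambda>x. (v x)\<^sup>2 + 2 * (v x * v' x) + (v' x)\<^sup>2) integrable_on {a..b}"
    by (intro Henstock_Kurzweil_Integration.integrable_add integrable_on_mult_right int
        set_lebesgue_integral_eq_integral(1)[OF square_integrable_mult] order_refl)
  then show "(\<lambda>x. (v x + v' x)\<^sup>2) integrable_on {a..b}"
    by (simp add: power2_sum algebra_simps)
  fix s t assume st: "a \<le> s" "s \<le> t" "t \<le> b"
  then have "{s..t} \<subseteq> {a..b}" by auto
  then have "integral {s..t} (\<lambda>x. v x + v' x) = integral {s..t} v + integral {s..t} v'"
    by (intro Henstock_Kurzweil_Integration.integral_add int)
  then show "u t + u' t - (u s + u' s) = integral {s..t} (\<lambda>x. v x + v' x)"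
    using assms st unfolding H1_primitive_def by (smt (verit, best))
qed

lemma H1_primitive_cmult:
  assumes "H1_primitive a b u v"
  shows "H1_primitive a b (\<lambda>x. c * u x) (\<lambda>x. c * v x)"
  unfolding H1_primitive_def
proof (intro conjI allI impI)
  note int = H1_primitive_integrable[OF assms]
  show "(\<lambda>x. c * v x) absolutely_integrable_on {a..b}"
    by (intro set_integrable_mult_right int order_refl)
  show "(\<lambda>x. (c * v x)\<^sup>2) integrable_on {a..b}"
    unfolding power_mult_distrib by (intro integrable_on_mult_right int order_refl)
  fix s t assume st: "a \<le> s" "s \<le> t" "t \<le> b"
  then have "u t - u s = integral {s..t} v" using assms unfolding H1_primitive_def by blast
  then show "c * u t - c * u s = integral {s..t} (\<lambda>x. c * v x)"
    by (simp flip: right_diff_distrib)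
qed

lemma H1_primitive_diff:
  assumes "H1_primitive a b u v" "H1_primitive a b u' v'"
  shows "H1_primitive a b (\<lambda>x. u x - u' x) (\<lambda>x. v x - v' x)"
  using H1_primitive_add[OF assms(1) H1_primitive_cmult[OF assms(2), of "-1"]] by simp

lemma H1_primitive_increment_le:
  assumes "H1_primitive a b u v" "a \<le> s" "s \<le> t" "t \<le> b" "r \<in> {s..t}" "q \<in> {s..t}"
  shows "\<bar>u r - u q\<bar> \<le> integral {s..t} (\<lambda>x. \<bar>v x\<bar>)"
proof -
  have aux: "\<bar>u r - u q\<bar> \<le> integral {s..t} (\<lambda>x. \<bar>v x\<bar>)" if "q \<le> r" "r \<in> {s..t}" "q \<in> {s..t}" for r q
  proof -
    have sub: "{q..r} \<subseteq> {s..t}" "{q..r} \<subseteq> {a..b}" "{s..t} \<subseteq> {a..b}" using that assms(2-4) by auto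
    have "u r - u q = integral {q..r} v"
      using assms(1-4) that unfolding H1_primitive_def by auto
    also have "\<bar>\<dots>\<bar> \<le> integral {q..r} (\<lambda>x. \<bar>v x\<bar>)"
      using Henstock_Kurzweil_Integration.integral_norm_bound_integral[of v "{q..r}" "\<lambda>x. \<bar>v x\<bar>"]
        H1_primitive_integrable[OF assms(1) sub(2)] by auto
    also have "\<dots> \<le> integral {s..t} (\<lambda>x. \<bar>v x\<bar>)"
      using H1_primitive_integrable[OF assms(1)] sub
      by (intro Henstock_Kurzweil_Integration.integral_subset_le) auto
    finally show ?thesis .
  qed
  show ?thesis
    using aux[of q r] aux[of r q] assms(5,6) by (cases "q \<le> r") (auto simp: abs_minus_commute)
qed

section \<open>Chain rule and product rule for primitives\<close>

lemma MVT_segment: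
  fixes \<phi> \<phi>' :: "real \<Rightarrow> real"
  assumes "\<And>x. (\<phi> has_real_derivative \<phi>' x) (at x)"
  obtains \<xi> where "min x y \<le> \<xi>" "\<xi> \<le> max x y" "\<phi> y - \<phi> x = \<phi>' \<xi> * (y - x)"
proof -
  have aux: "\<exists>\<xi>. p \<le> \<xi> \<and> \<xi> \<le> q \<and> \<phi> q - \<phi> p = \<phi>' \<xi> * (q - p)" if "p < q" for p q
    using MVT2[OF that assms] by (metis less_imp_le mult.commute)
  consider "x < y" | "y < x" | "x = y" by linarith
  then show ?thesis
  proof cases
    case 1
    with aux[OF 1] that show ?thesis by (metis max.absorb4 min.absorb3)
  next
    case 2
    then obtain \<xi> where \<xi>: "y \<le> \<xi>" "\<xi> \<le> x" "\<phi> x - \<phi> y = \<phi>' \<xi> * (x - y)" using aux by blast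
    then have "\<phi> y - \<phi> x = \<phi>' \<xi> * (y - x)" by (simp add: algebra_simps)
    with \<xi> 2 show ?thesis by (intro that[of \<xi>]) auto
  next
    case 3
    then show ?thesis using that[of x] by simp
  qed
qed

text \<open>Divided by \<open>t - s\<close>, the bound shows that difference quotients of
  \<open>Q\<close> are dominated by increments of the continuous \<open>A\<close>, so
  \<open>Q\<close> has derivative 0 everywhere.\<close>

lemma constant_on_Icc_if_increment_le:
  fixes Q A :: "real \<Rightarrow> real"
  assumes A: "continuous_on {a..b} A"
    and le: "\<And>s t. a \<le> s \<Longrightarrow> s \<le> t \<Longrightarrow> t \<le> b \<Longrightarrow> \<bar>Q t - Q s\<bar> \<le> (t - s) * (A t - A s)"
    and "x \<in> {a..b}" "y \<in> {a..b}"
  shows "Q x = Q y"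
proof -
  have "(Q has_real_derivative 0) (at x within {a..b})" if x: "x \<in> {a..b}" for x
    unfolding has_field_derivative_iff
  proof (rule Lim_null_comparison)
    show "((\<lambda>y. \<bar>A y - A x\<bar>) \<longlongrightarrow> 0) (at x within {a..b})"
      using A x unfolding continuous_on_def by (auto intro!: tendsto_eq_intros)
    have "norm ((Q y - Q x) / (y - x)) \<le> \<bar>A y - A x\<bar>" if y: "y \<in> {a..b}" "y \<noteq> x" for y
    proof -
      have "\<bar>Q y - Q x\<bar> \<le> \<bar>A y - A x\<bar> * \<bar>y - x\<bar>"
      proof (cases "x \<le> y")
        case True
        have "\<bar>Q y - Q x\<bar> \<le> (y - x) * (A y - A x)" using le[of x y] x y True by auto
        also have "\<dots> \<le> (y - x) * \<bar>A y - A x\<bar>" using True by (intro mult_left_mono) auto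
        finally show ?thesis using True by (simp add: mult.commute)
      next
        case False
        have "\<bar>Q x - Q y\<bar> \<le> (x - y) * (A x - A y)" using le[of y x] x y False by auto
        also have "\<dots> \<le> (x - y) * \<bar>A x - A y\<bar>" using False by (intro mult_left_mono) auto
        finally show ?thesis using False by (simp add: mult.commute abs_minus_commute)
      qed
      then show ?thesis using y by (simp add: field_simps)
    qed
    then show "\<forall>\<^sub>F y in at x within {a..b}. norm ((Q y - Q x) / (y - x)) \<le> \<bar>A y - A x\<bar>"
      by (auto simp: eventually_at_filter)
  qed
  then obtain c where "\<And>x. x \<in> {a..b} \<Longrightarrow> Q x = c"
    using has_field_derivative_zero_constant[of "{a..b}" Q] by auto
  with assms(3,4) show ?thesis by metis
qed

text \<open>The error of the chain rule on \<open>{s..t}\<close> is at most \<open>L * (\<integral>\<bar>v\<bar>)\<^sup>2 \<le> L * (t - s) * \<integral>v\<^sup>2\<close>, which is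
  \<open>o(t - s)\<close>: no almost everywhere differentiability is needed.\<close>

lemma H1_primitive_compose:
  fixes \<phi> \<phi>' \<phi>'' :: "real \<Rightarrow> real"
  assumes uv: "H1_primitive a b u v"
    and \<phi>: "\<And>x. (\<phi> has_real_derivative \<phi>' x) (at x)" "\<And>x. (\<phi>' has_real_derivative \<phi>'' x) (at x)"
      "continuous_on UNIV \<phi>''"
  shows "H1_primitive a b (\<lambda>x. \<phi> (u x)) (\<lambda>x. \<phi>' (u x) * v x)"
proof -
  note int = H1_primitive_integrable[OF uv]
  have u_cont: "continuous_on {a..b} u" by (rule H1_primitive_continuous[OF uv])
  have \<phi>'_cont: "continuous_on A \<phi>'" for A
    using \<phi>(2) DERIV_isCont continuous_at_imp_continuous_on by blast
  have comp_cont: "continuous_on {a..b} (\<lambda>x. \<phi>' (u x))"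
    by (rule continuous_on_compose2[OF \<phi>'_cont u_cont order_refl])
  have abs_int: "(\<lambda>x. \<phi>' (u x) * v x) absolutely_integrable_on {a..b}"
    by (rule absolutely_integrable_continuous_mult[OF comp_cont int(1)[OF order_refl]])
  have "(\<lambda>x. (v x)\<^sup>2) absolutely_integrable_on {a..b}"
    using int(4)[OF order_refl] by (intro nonnegative_absolutely_integrable_1) auto
  then have "(\<lambda>x. (\<phi>' (u x))\<^sup>2 * (v x)\<^sup>2) absolutely_integrable_on {a..b}"
    by (intro absolutely_integrable_continuous_mult continuous_intros comp_cont)
  then have sq_int: "(\<lambda>x. (\<phi>' (u x) * v x)\<^sup>2) integrable_on {a..b}"
    by (simp add: power_mult_distrib set_lebesgue_integral_eq_integral(1))
  have "bounded (u ` {a..b})"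
    by (intro compact_imp_bounded compact_continuous_image u_cont) simp
  then obtain B where B: "\<And>x. x \<in> {a..b} \<Longrightarrow> \<bar>u x\<bar> \<le> B"
    unfolding bounded_iff by force
  have "bounded (\<phi>'' ` {-B..B})"
    by (intro compact_imp_bounded compact_continuous_image continuous_on_subset[OF \<phi>(3)]) auto
  then obtain L where L: "\<And>x. x \<in> {-B..B} \<Longrightarrow> \<bar>\<phi>'' x\<bar> \<le> L"
    unfolding bounded_iff by force
  have Lip: "\<bar>\<phi>' y - \<phi>' x\<bar> \<le> L * \<bar>y - x\<bar>" if "\<bar>x\<bar> \<le> B" "\<bar>y\<bar> \<le> B" for x y
  proof -
    obtain \<xi> where \<xi>: "min x y \<le> \<xi>" "\<xi> \<le> max x y" "\<phi>' y - \<phi>' x = \<phi>'' \<xi> * (y - x)"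
      using MVT_segment[OF \<phi>(2)] by blast
    have "\<bar>\<phi>'' \<xi>\<bar> \<le> L" using \<xi> that by (intro L) auto
    then show ?thesis unfolding \<xi>(3) abs_mult by (intro mult_right_mono) auto
  qed
  \<comment> \<open>\<open>Q\<close> measures the failure of the chain rule, and \<open>L\<close> is
    a Lipschitz constant of \<open>\<phi>'\<close> on a range containing the values of
    \<open>u\<close>. The increments of \<open>A\<close> are the error density
    \<open>L * v^2\<close> integrated, which is the form required by
    \<open>constant_on_Icc_if_increment_le\<close>.\<close>
  define A where "A t = L * integral {a..t} (\<lambda>x. (v x)\<^sup>2)" for t
  define Q where "Q t = \<phi> (u t) - integral {a..t} (\<lambda>x. \<phi>' (u x) * v x)" for t
  have A_cont: "continuous_on {a..b} A"
    unfolding A_def by (intro continuous_intros indefinite_integral_continuous_1 int(4) order_refl)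
  have \<phi>'v_int: "(\<lambda>x. \<phi>' (u x) * v x) integrable_on {s..t}" if "{s..t} \<subseteq> {a..b}" for s t
    using integrable_subinterval_real[OF set_lebesgue_integral_eq_integral(1)[OF abs_int] that] .
  have Q_diff: "Q t - Q s = \<phi> (u t) - \<phi> (u s) - integral {s..t} (\<lambda>x. \<phi>' (u x) * v x)"
    and A_diff: "A t - A s = L * integral {s..t} (\<lambda>x. (v x)\<^sup>2)"
    if "a \<le> s" "s \<le> t" "t \<le> b" for s t
  proof -
    have sub: "{a..t} \<subseteq> {a..b}" using that by auto
    show "Q t - Q s = \<phi> (u t) - \<phi> (u s) - integral {s..t} (\<lambda>x. \<phi>' (u x) * v x)"
      unfolding Q_def using Henstock_Kurzweil_Integration.integral_combine[OF that(1,2) \<phi>'v_int[OF sub]] by simp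
    show "A t - A s = L * integral {s..t} (\<lambda>x. (v x)\<^sup>2)"
      unfolding A_def using Henstock_Kurzweil_Integration.integral_combine[OF that(1,2) int(4)[OF sub]]
      by (simp flip: right_diff_distrib)
  qed
  have Q_const: "Q s = Q t" if "s \<in> {a..b}" "t \<in> {a..b}" for s t
  proof (rule constant_on_Icc_if_increment_le[OF A_cont _ that])
    fix s t assume st: "a \<le> s" "s \<le> t" "t \<le> b"
    then have sub: "{s..t} \<subseteq> {a..b}" by auto
    define m where "m = integral {s..t} (\<lambda>x. \<bar>v x\<bar>)"
    have m: "\<bar>u r - u q\<bar> \<le> m" if "r \<in> {s..t}" "q \<in> {s..t}" for r q
      unfolding m_def by (rule H1_primitive_increment_le[OF uv st that])
    have "L \<ge> 0" using L[of "u a"] B[of a] st by force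
    \<comment> \<open>The mean value theorem freezes \<open>\<phi>'\<close> at a point between
      \<open>u s\<close> and \<open>u t\<close>. Every \<open>u r\<close> with \<open>r\<close> in
      \<open>{s..t}\<close> lies within \<open>m\<close> of it, so replacing
      \<open>\<phi>' (u r)\<close> by \<open>\<phi>' \<xi>\<close> costs at most
      \<open>L * m\<close>.\<close>
    obtain \<xi> where \<xi>: "min (u s) (u t) \<le> \<xi>" "\<xi> \<le> max (u s) (u t)" "\<phi> (u t) - \<phi> (u s) = \<phi>' \<xi> * (u t - u s)"
      using MVT_segment[OF \<phi>(1)] by blast
    have \<xi>B: "\<bar>\<xi>\<bar> \<le> B" using B[of s] B[of t] \<xi> st by auto
    have bound: "norm (\<phi>' \<xi> * v r - \<phi>' (u r) * v r) \<le> L * m * \<bar>v r\<bar>" if r: "r \<in> {s..t}" for r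
    proof -
      have "\<bar>u r - \<xi>\<bar> \<le> m" using m[OF r, of s] m[OF r, of t] \<xi>(1,2) st by auto
      then have "L * \<bar>u r - \<xi>\<bar> \<le> L * m" using \<open>L \<ge> 0\<close> by (rule mult_left_mono)
      moreover have "\<bar>\<phi>' (u r) - \<phi>' \<xi>\<bar> \<le> L * \<bar>u r - \<xi>\<bar>"
        by (rule Lip[OF \<xi>B B]) (use r sub in auto)
      ultimately have "\<bar>\<phi>' \<xi> - \<phi>' (u r)\<bar> * \<bar>v r\<bar> \<le> L * m * \<bar>v r\<bar>"
        by (intro mult_right_mono) (auto simp: abs_minus_commute)
      then show ?thesis by (simp add: abs_mult flip: left_diff_distrib)
    qed
    have \<xi>v_int: "(\<lambda>x. \<phi>' \<xi> * v x) integrable_on {s..t}"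
      by (intro integrable_on_mult_right int(2) sub)
    have "Q t - Q s = \<phi>' \<xi> * integral {s..t} v - integral {s..t} (\<lambda>x. \<phi>' (u x) * v x)"
      using Q_diff[OF st] \<xi>(3) uv st unfolding H1_primitive_def by simp
    also have "\<dots> = integral {s..t} (\<lambda>x. \<phi>' \<xi> * v x - \<phi>' (u x) * v x)"
      by (subst Henstock_Kurzweil_Integration.integral_diff[OF \<xi>v_int \<phi>'v_int[OF sub]]) simp
    also have "norm \<dots> \<le> integral {s..t} (\<lambda>x. L * m * \<bar>v x\<bar>)"
      by (intro Henstock_Kurzweil_Integration.integral_norm_bound_integral
          Henstock_Kurzweil_Integration.integrable_diff \<xi>v_int \<phi>'v_int[OF sub]
          integrable_on_mult_right int(3)[OF sub] bound)
    also have "\<dots> = L * m\<^sup>2" by (simp add: m_def power2_eq_square)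
    \<comment> \<open>Cauchy-Schwarz for \<open>\<bar>v\<bar>\<close> gains the factor
      \<open>t - s\<close>.\<close>
    also have "\<dots> \<le> L * ((t - s) * integral {s..t} (\<lambda>x. (v x)\<^sup>2))"
      using integral_squared_le[OF st(2) int(3)[OF sub]] int(4)[OF sub] \<open>L \<ge> 0\<close>
      by (intro mult_left_mono) (auto simp: m_def)
    finally show "\<bar>Q t - Q s\<bar> \<le> (t - s) * (A t - A s)"
      unfolding A_diff[OF st] by (simp add: mult_ac)
  qed
  show ?thesis
    unfolding H1_primitive_def
  proof (intro conjI allI impI abs_int sq_int)
    fix s t assume st: "a \<le> s" "s \<le> t" "t \<le> b"
    then have "Q s = Q t" by (intro Q_const) auto
    then show "\<phi> (u t) - \<phi> (u s) = integral {s..t} (\<lambda>x. \<phi>' (u x) * v x)"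
      using Q_diff[OF st] by simp
  qed
qed

text \<open>Polarisation: the product is half of \<open>(u + u')^2 - u^2 - u'^2\<close>, so the
  chain rule for squares suffices.\<close>

lemma H1_primitive_mult:
  assumes "H1_primitive a b u v" "H1_primitive a b u' v'"
  shows "H1_primitive a b (\<lambda>x. u x * u' x) (\<lambda>x. v x * u' x + u x * v' x)"
proof -
  have sq: "H1_primitive a b (\<lambda>x. (w x)\<^sup>2) (\<lambda>x. 2 * w x * w' x)" if "H1_primitive a b w w'" for w w'
    by (rule H1_primitive_compose[OF that, of "\<lambda>x. x\<^sup>2" "\<lambda>x. 2 * x" "\<lambda>x. 2"])
      (auto intro!: derivative_eq_intros)
  have "H1_primitive a b (\<lambda>x. 1 / 2 * ((u x + u' x)\<^sup>2 - (u x)\<^sup>2 - (u' x)\<^sup>2))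
      (\<lambda>x. 1 / 2 * (2 * (u x + u' x) * (v x + v' x) - 2 * u x * v x - 2 * u' x * v' x))"
    by (intro H1_primitive_cmult H1_primitive_diff sq H1_primitive_add assms)
  then show ?thesis
    by (simp add: power2_sum algebra_simps)
qed

section \<open>From weak derivatives to primitives\<close>

lemma AE_lebesgue_imp_negligible:
  fixes Q :: "real \<Rightarrow> bool"
  assumes "AE x in lebesgue. Q x"
  shows "\<exists>N. negligible N \<and> (\<forall>x. x \<notin> N \<longrightarrow> Q x)"
  using assms unfolding eventually_ae_filter negligible_iff_null_sets by auto

lemma has_weak_deriv_on_integrable:
  assumes "has_weak_deriv_on U u v" "{a..b} \<subseteq> U"
  shows "v absolutely_integrable_on {a..b}" "v integrable_on {a..b}"
  using assms set_lebesgue_integral_eq_integral(1)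
  unfolding has_weak_deriv_on_def loc_integrable_on_def by blast+

text \<open>Over every compact interval in \<open>W\<close> both weak derivatives integrate to the
  increment of the same continuous function. The smaller set \<open>W\<close> allows a comparison of
  the solution with its initial datum.\<close>

lemma has_weak_deriv_on_unique:
  assumes U: "open U" "open W" "W \<subseteq> U" and u: "continuous_on U u" "has_weak_deriv_on U u v"
    and w: "has_weak_deriv_on W w h" "\<And>x. x \<in> W \<Longrightarrow> u x = w x"
  shows "AE x in lebesgue. x \<in> W \<longrightarrow> h x = v x"
proof (rule AE_eq_on_open_if_integrals_eq[OF U(2)])
  show "h integrable_on {a..b}" if "{a..b} \<subseteq> W" for a b
    using has_weak_deriv_on_integrable[OF w(1) that] by simp
  show "v integrable_on {a..b}" if "{a..b} \<subseteq> W" for a b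
    using has_weak_deriv_on_integrable[OF u(2)] that U(3) by blast
  fix a b :: real assume ab: "a \<le> b" "{a..b} \<subseteq> W"
  have "continuous_on W w"
    using continuous_on_subset[OF u(1) U(3)] w(2) by (rule continuous_on_eq)
  then have "w b - w a = integral {a..b} h"
    by (rule has_weak_deriv_on_imp_integral[OF U(2) ab(2,1) _ w(1)])
  moreover have "u b - u a = integral {a..b} v"
    using ab U by (intro has_weak_deriv_on_imp_integral[OF U(1) _ _ u]) auto
  moreover have "a \<in> W" "b \<in> W" using ab by auto
  ultimately show "integral {a..b} h = integral {a..b} v" using w(2) by simp
qed

text \<open>\<open>H1_loc_on\<close> only asserts that some weak derivative is locally square
  integrable; uniqueness transfers this to the given representative \<open>v\<close>.\<close>

lemma H1_loc_on_imp_H1_primitive: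
  assumes U: "open U" "{a..b} \<subseteq> U"
    and u: "H1_loc_on U u" "continuous_on U u" "has_weak_deriv_on U u v"
  shows "H1_primitive a b u v"
proof -
  obtain h where h: "has_weak_deriv_on U u h" "L2_loc_on U h"
    using u(1) unfolding H1_loc_on_def by blast
  have "AE x in lebesgue. x \<in> U \<longrightarrow> h x = v x"
    by (rule has_weak_deriv_on_unique[OF U(1,1) order_refl u(2,3) h(1) refl])
  then obtain N where N: "negligible N" "\<And>x. x \<notin> N \<Longrightarrow> x \<in> U \<longrightarrow> h x = v x"
    using AE_lebesgue_imp_negligible by blast
  have "(\<lambda>x. (h x)\<^sup>2) integrable_on {a..b}"
    using h(2) U(2) set_lebesgue_integral_eq_integral(1) unfolding L2_loc_on_def L2_on_def by blast
  then have "(\<lambda>x. (v x)\<^sup>2) integrable_on {a..b}"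
    by (rule integrable_spike[OF _ N(1)]) (use N(2) U(2) in auto)
  moreover have "u t - u s = integral {s..t} v" if "a \<le> s" "s \<le> t" "t \<le> b" for s t
    using that U by (intro has_weak_deriv_on_imp_integral[OF U(1) _ _ u(2,3)]) auto
  ultimately show ?thesis
    using has_weak_deriv_on_integrable[OF u(3) U(2)] unfolding H1_primitive_def by blast
qed

text \<open>Local regularity on an open \<open>U\<close> gives no control at an end point that may
  lie on the boundary of \<open>U\<close>. The global regularity of \<open>u0\<close> supplies it,
  up to and including the end points.\<close>

lemma H1_on_Ioo_imp_weak_deriv_integrable:
  assumes "H1_on {a<..<b} u0" "open U" "{a<..<b} \<subseteq> U"
    and u: "continuous_on U u" "has_weak_deriv_on U u v" "\<And>x. x \<in> {a<..<b} \<Longrightarrow> u x = u0 x"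
  shows "v integrable_on {a..b}" "(\<lambda>x. (v x)\<^sup>2) integrable_on {a..b}"
proof -
  obtain h where h: "has_weak_deriv_on {a<..<b} u0 h" "L2_on {a<..<b} h"
    using assms(1) unfolding H1_on_def by blast
  have "AE x in lebesgue. x \<in> {a<..<b} \<longrightarrow> h x = v x"
    by (rule has_weak_deriv_on_unique[OF assms(2) _ assms(3) u(1,2) h(1) u(3)]) auto
  then obtain N where N: "negligible N" "\<And>x. x \<notin> N \<Longrightarrow> x \<in> {a<..<b} \<longrightarrow> h x = v x"
    using AE_lebesgue_imp_negligible by blast
  have h2: "(\<lambda>x. (h x)\<^sup>2) integrable_on {a<..<b}"
    using h(2) set_lebesgue_integral_eq_integral(1) unfolding L2_on_def by blast
  have "h absolutely_integrable_on {a<..<b}"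
  proof (rule measurable_bounded_by_integrable_imp_absolutely_integrable)
    show "h \<in> borel_measurable (lebesgue_on {a<..<b})" using h(2) unfolding L2_on_def by blast
    have "(\<lambda>x. 1 :: real) integrable_on {a<..<b}"
      using integrable_const_ivl[of "1::real" a b] by (simp only: integrable_on_Icc_iff_Ioo)
    then show "(\<lambda>x. 1 + (h x)\<^sup>2) integrable_on {a<..<b}"
      using h2 by (intro Henstock_Kurzweil_Integration.integrable_add)
    \<comment> \<open>On a bounded interval this majorant is integrable, so square integrability
      implies integrability.\<close>
    show "norm (h x) \<le> 1 + (h x)\<^sup>2" for x
      using zero_le_power2[of "\<bar>h x\<bar> - 1"] by (simp add: power2_diff)
  qed auto
  then have "h integrable_on {a<..<b}" by (rule set_lebesgue_integral_eq_integral(1))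
  then have "v integrable_on {a<..<b}"
    by (rule integrable_spike[OF _ N(1)]) (use N(2) in auto)
  then show "v integrable_on {a..b}" by (simp only: integrable_on_Icc_iff_Ioo)
  have "(\<lambda>x. (v x)\<^sup>2) integrable_on {a<..<b}"
    using h2 by (rule integrable_spike[OF _ N(1)]) (use N(2) in auto)
  then show "(\<lambda>x. (v x)\<^sup>2) integrable_on {a..b}" by (simp only: integrable_on_Icc_iff_Ioo)
qed

section \<open>Energy method\<close>

text \<open>If \<open>\<bar>z t\<bar> \<ge> e\<close>, Hoelder continuity with exponent 1/2 keeps
  \<open>\<bar>z\<bar> \<ge> e / 2\<close> on a window whose length depends only on \<open>e\<close>
  and \<open>K\<close>. Each such window adds a fixed amount to the integral of \<open>z^2\<close>,
  which is impossible once that integral is close to its supremum.\<close>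

lemma Barbalat_square_integrable:
  fixes z :: "real \<Rightarrow> real"
  assumes int: "\<And>t. t \<ge> 0 \<Longrightarrow> (\<lambda>x. (z x)\<^sup>2) integrable_on {0..t}"
    and le: "\<And>t. t \<ge> 0 \<Longrightarrow> integral {0..t} (\<lambda>x. (z x)\<^sup>2) \<le> C"
    and holder: "\<And>s t. 0 \<le> s \<Longrightarrow> s \<le> t \<Longrightarrow> t \<le> s + 1 \<Longrightarrow> (z t - z s)\<^sup>2 \<le> (t - s) * K"
  shows "(z \<longlongrightarrow> 0) at_top"
proof (rule tendstoI)
  fix e :: real assume e: "e > 0"
  have K: "K \<ge> 0" using holder[of 0 1] by (simp add: order_trans[OF zero_le_power2])
  \<comment> \<open>Chosen so that \<open>\<delta> * K \<le> (e / 2)^2\<close>. The summand 1 avoids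
    division by 0, and the cap at 1 keeps the window in the range of the Hoelder hypothesis.\<close>
  define \<delta> where "\<delta> = min 1 (e\<^sup>2 / (4 * (K + 1)))"
  have \<delta>: "\<delta> > 0" "\<delta> \<le> 1" using e K by (auto simp: \<delta>_def)
  have "\<delta> * K \<le> (e\<^sup>2 / (4 * (K + 1))) * (K + 1)"
    using K \<delta> by (intro mult_mono) (auto simp: \<delta>_def)
  also have "\<dots> = (e / 2)\<^sup>2" using K by (simp add: power_divide field_simps)
  finally have \<delta>K: "\<delta> * K \<le> (e / 2)\<^sup>2" .
  define J where "J t = integral {0..t} (\<lambda>x. (z x)\<^sup>2)" for t
  have J_diff: "J t = J s + integral {s..t} (\<lambda>x. (z x)\<^sup>2)" if "0 \<le> s" "s \<le> t" for s t
    unfolding J_def using Henstock_Kurzweil_Integration.integral_combine[OF that int] that by auto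
  have bdd: "bdd_above (J ` {0..})"
    using le by (intro bdd_aboveI[of _ C]) (auto simp: J_def)
  \<comment> \<open>After \<open>t0\<close> the integral can grow by less than
    \<open>\<delta> * (e / 2)^2\<close>, the least contribution of one window.\<close>
  have "Sup (J ` {0..}) - \<delta> * (e / 2)\<^sup>2 < Sup (J ` {0..})" using \<delta> e by simp
  then obtain t0 where t0: "t0 \<ge> 0" "Sup (J ` {0..}) - \<delta> * (e / 2)\<^sup>2 < J t0"
    using less_cSup_iff[OF _ bdd] by auto
  have "\<bar>z t\<bar> < e" if t: "t \<ge> t0" for t
  proof (rule ccontr)
    assume "\<not> \<bar>z t\<bar> < e"
    then have zt: "e \<le> \<bar>z t\<bar>" by simp
    have lower: "(e / 2)\<^sup>2 \<le> (z s)\<^sup>2" if s: "s \<in> {t..t + \<delta>}" for s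
    proof -
      have "(z s - z t)\<^sup>2 \<le> (s - t) * K" using s t t0 \<delta> by (intro holder) auto
      also have "\<dots> \<le> \<delta> * K" using s K by (intro mult_right_mono) auto
      finally have "(z s - z t)\<^sup>2 \<le> (e / 2)\<^sup>2" using \<delta>K by simp
      then have "\<bar>z s - z t\<bar> \<le> \<bar>e / 2\<bar>" by (simp only: abs_le_square_iff)
      then have "\<bar>e / 2\<bar> \<le> \<bar>z s\<bar>" using zt e by linarith
      then show ?thesis by (simp only: abs_le_square_iff)
    qed
    have "integral {t..t + \<delta>} (\<lambda>x. (e / 2)\<^sup>2) \<le> integral {t..t + \<delta>} (\<lambda>x. (z x)\<^sup>2)"
      using t t0 \<delta> lower
      by (intro Henstock_Kurzweil_Integration.integral_le integrable_subinterval_real[OF int[of "t + \<delta>"]]) auto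
    then have "\<delta> * (e / 2)\<^sup>2 \<le> J (t + \<delta>) - J t"
      using J_diff[of t "t + \<delta>"] t t0 \<delta> by simp
    moreover have "J t0 \<le> J t"
      using J_diff[of t0 t] t t0 integrable_subinterval_real[OF int[of t]]
      by (auto intro!: Henstock_Kurzweil_Integration.integral_nonneg)
    moreover have "J (t + \<delta>) \<le> Sup (J ` {0..})"
      using t t0 \<delta> by (intro cSup_upper bdd) auto
    ultimately show False using t0 by linarith
  qed
  then show "eventually (\<lambda>t. dist (z t) 0 < e) at_top"
    unfolding eventually_at_top_linorder by (auto simp: dist_real_def)
qed

text \<open>The dissipation inequality in integrated form. The sliding window is never
  differentiated: its change over \<open>{0..t}\<close> is the integral of
  \<open>v(r)^2 - v(r - 1)^2\<close>.\<close>

lemma neutral_energy_estimate: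
  fixes c t \<theta> :: real and f f' f'' \<Phi> y y' P P' v g G :: "real \<Rightarrow> real"
  assumes c: "c \<in> {-1, 1}" and t: "t \<ge> 0"
    and f: "\<And>x. (\<Phi> has_real_derivative f x) (at x)" "\<And>x. (f has_real_derivative f' x) (at x)"
      "\<And>x. (f' has_real_derivative f'' x) (at x)" "continuous_on UNIV f''"
    and yP: "H1_primitive 0 t y y'" "H1_primitive 0 t P P'"
    and v_def: "v = (\<lambda>r. y' r - P' r)" and v_sq: "(\<lambda>r. (v r)\<^sup>2) integrable_on {-1..t}"
    and g_def: "g = (\<lambda>r. f (y r) - f (P r))"
    and G_def: "G = (\<lambda>r. \<Phi> (y r) - \<Phi> (P r) - f (P r) * (y r - P r))"
    and eq: "AE r in lebesgue. r > 0 \<longrightarrow> v r + c * v (r - 1) + g r = 0"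
    and bound: "AE r in lebesgue. r > 0 \<longrightarrow> 2 * P' r * (g r - f' (P r) * (y r - P r)) \<le> \<theta> * (g r)\<^sup>2"
  shows "integral {t-1..t} (\<lambda>r. (v r)\<^sup>2) + 2 * G t + (1 - \<theta>) * integral {0..t} (\<lambda>r. (g r)\<^sup>2)
    \<le> integral {-1..0} (\<lambda>r. (v r)\<^sup>2) + 2 * G 0"
proof -
  \<comment> \<open>The weak derivative of \<open>G\<close> by the chain and product rules; the
    terms \<open>f (P r) * P' r\<close> cancel, which leads to the form in
    \<open>d_eq\<close>.\<close>
  define d where "d r = f (y r) * y' r - f (P r) * P' r -
    ((f' (P r) * P' r) * (y r - P r) + f (P r) * (y' r - P' r))" for r
  have f'_cont: "continuous_on UNIV f'" and f_cont: "continuous_on UNIV f"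
    by (simp_all add: continuous_at_imp_continuous_on DERIV_isCont[OF f(2)] DERIV_isCont[OF f(3)])
  have "H1_primitive 0 t G d"
    unfolding G_def d_def
    by (rule H1_primitive_diff[OF H1_primitive_diff[OF H1_primitive_compose[OF yP(1) f(1,2) f'_cont]
          H1_primitive_compose[OF yP(2) f(1,2) f'_cont]]
          H1_primitive_mult[OF H1_primitive_compose[OF yP(2) f(2,3,4)] H1_primitive_diff[OF yP]]])
  then have G: "G t - G 0 = integral {0..t} d" and d_int: "d integrable_on {0..t}"
    using t H1_primitive_integrable(2)[OF _ order_refl] unfolding H1_primitive_def by auto
  have d_eq: "d r = g r * v r + P' r * (g r - f' (P r) * (y r - P r))" for r
    unfolding d_def g_def v_def by (simp add: algebra_simps)
  have "continuous_on {0..t} g"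
    unfolding g_def
    by (intro continuous_on_diff continuous_on_compose2[OF f_cont _ subset_UNIV]
        H1_primitive_continuous[OF yP(1)] H1_primitive_continuous[OF yP(2)])
  then have g_int: "(\<lambda>r. (g r)\<^sup>2) integrable_on {0..t}"
    by (intro integrable_continuous_real continuous_intros)
  have v_int: "(\<lambda>r. (v r)\<^sup>2) integrable_on {p..q}" if "-1 \<le> p" "q \<le> t" for p q
    using v_sq by (rule integrable_subinterval_real) (use that in auto)
  have shift_int: "(\<lambda>r. (v (r + -1))\<^sup>2) integrable_on {0..t}"
    using integrable_shift_real_ivl[OF v_int[of "-1" "t - 1"], of "-1"] by simp
  have shift: "integral {0..t} (\<lambda>r. (v (r + -1))\<^sup>2) = integral {-1..t-1} (\<lambda>r. (v r)\<^sup>2)"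
    using integral_shift_real_ivl[of "-1" "-1" "t - 1" "\<lambda>r. (v r)\<^sup>2"] by simp
  \<comment> \<open>Its integral is the change of the energy plus the dissipation
    \<open>(1 - \<theta>) * g^2\<close>; the claim reduces to \<open>h \<le> 0\<close> almost
    everywhere.\<close>
  define h where "h r = (v r)\<^sup>2 - (v (r + -1))\<^sup>2 + 2 * d r + (1 - \<theta>) * (g r)\<^sup>2" for r
  have h_int: "h integrable_on {0..t}"
    unfolding h_def using v_int[of 0 t] shift_int d_int g_int
    by (intro Henstock_Kurzweil_Integration.integrable_add Henstock_Kurzweil_Integration.integrable_diff
        integrable_on_mult_right) auto
  have h_val: "(h has_integral integral {0..t} (\<lambda>r. (v r)\<^sup>2) - integral {-1..t-1} (\<lambda>r. (v r)\<^sup>2)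
      + 2 * (G t - G 0) + (1 - \<theta>) * integral {0..t} (\<lambda>r. (g r)\<^sup>2)) {0..t}"
    unfolding h_def G shift[symmetric] using v_int[of 0 t] shift_int d_int g_int
    by (intro has_integral_add has_integral_diff has_integral_mult_right integrable_integral) auto
  obtain N1 where N1: "negligible N1"
    "\<And>r. r \<notin> N1 \<Longrightarrow> r > 0 \<longrightarrow> v r + c * v (r - 1) + g r = 0"
    using AE_lebesgue_imp_negligible[OF eq] by blast
  obtain N2 where N2: "negligible N2"
    "\<And>r. r \<notin> N2 \<Longrightarrow> r > 0 \<longrightarrow> 2 * P' r * (g r - f' (P r) * (y r - P r)) \<le> \<theta> * (g r)\<^sup>2"
    using AE_lebesgue_imp_negligible[OF bound] by blast
  \<comment> \<open>The point 0 joins the exceptional set because the equation and the bound are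
    assumed for \<open>r > 0\<close> only.\<close>
  define N where "N = insert 0 (N1 \<union> N2)"
  have N: "negligible N" using N1(1) N2(1) by (simp add: N_def)
  have h_le: "h r \<le> 0" if "r \<in> {0..t} - N" for r
  proof -
    have r: "r > 0" "r \<notin> N1" "r \<notin> N2" using that by (auto simp: N_def)
    then have "c * v (r - 1) = - (v r + g r)" using N1(2) by force
    moreover have "c\<^sup>2 = 1" using c by auto
    ultimately have "(v (r - 1))\<^sup>2 = (v r + g r)\<^sup>2"
      by (metis mult_1 power2_minus power_mult_distrib)
    \<comment> \<open>Since \<open>v(r - 1)^2 = (v + g)^2\<close>, the cross term
      \<open>-2 * g * v\<close> cancels against the part \<open>g * v\<close> of \<open>d\<close>,
      and \<open>-g^2\<close> against the 1 in \<open>1 - \<theta>\<close>.\<close>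
    then have "h r = 2 * P' r * (g r - f' (P r) * (y r - P r)) - \<theta> * (g r)\<^sup>2"
      unfolding h_def d_eq by (simp add: power2_sum algebra_simps)
    then show ?thesis using N2(2) r by simp
  qed
  have "integral {0..t} h = integral {0..t} (\<lambda>r. if r \<in> N then 0 else h r)"
    by (rule integral_spike[OF N]) auto
  also have "\<dots> \<le> integral {0..t} (\<lambda>r. 0)"
  proof (rule Henstock_Kurzweil_Integration.integral_le)
    show "(\<lambda>r. if r \<in> N then 0 else h r) integrable_on {0..t}"
      by (rule integrable_spike[OF h_int N]) auto
  qed (use h_le in auto)
  finally have "integral {0..t} h \<le> 0" by simp
  then have "integral {0..t} (\<lambda>r. (v r)\<^sup>2) - integral {-1..t-1} (\<lambda>r. (v r)\<^sup>2)
      + 2 * (G t - G 0) + (1 - \<theta>) * integral {0..t} (\<lambda>r. (g r)\<^sup>2) \<le> 0"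
    using integral_unique[OF h_val] by simp
  \<comment> \<open>Splitting \<open>{-1..t}\<close> at \<open>t - 1\<close> and at 0 turns the two
    long integrals into the windows at times \<open>t\<close> and 0.\<close>
  moreover have "integral {-1..t-1} (\<lambda>r. (v r)\<^sup>2) + integral {t-1..t} (\<lambda>r. (v r)\<^sup>2)
      = integral {-1..0} (\<lambda>r. (v r)\<^sup>2) + integral {0..t} (\<lambda>r. (v r)\<^sup>2)"
    using Henstock_Kurzweil_Integration.integral_combine[OF _ _ v_sq, of "t - 1"]
      Henstock_Kurzweil_Integration.integral_combine[OF _ _ v_sq, of 0] t by simp
  ultimately show ?thesis by (simp add: algebra_simps)
qed

section \<open>The antiderivative of \<open>f\<close> and the dissipation margin\<close>

lemma continuous_antiderivative_exists:
  fixes f :: "real \<Rightarrow> real"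
  assumes "\<And>x. isCont f x"
  obtains \<Phi> where "\<And>x. (\<Phi> has_real_derivative f x) (at x)"
  using einterval_antiderivative[of "-\<infinity>" \<infinity> f] assms
  by (auto simp: has_real_derivative_iff_has_vector_derivative)

text \<open>A real \<open>m\<close> strictly between the two sides exists even if the infimum is
  infinite. With \<open>M\<close> the essential supremum, \<theta> is
  \<open>2 * M / m\<close>.\<close>

lemma remainder_bound_of_less_INF:
  fixes f f' :: "real \<Rightarrow> real" and P' :: "real \<Rightarrow> real"
  assumes less: "2 * esssup lebesgue (\<lambda>t. ereal \<bar>P' t\<bar>) <
      (INF (w, d) \<in> {(w, d). w \<in> I \<and> d \<in> D \<and> \<bar>f w - f d - (w - d) * f' d\<bar> \<noteq> 0}.
         ereal ((f w - f d)\<^sup>2 / \<bar>f w - f d - (w - d) * f' d\<bar>))"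
  obtains \<theta> where "\<theta> < 1"
    "AE t in lebesgue. \<forall>w\<in>I. \<forall>d\<in>D. 2 * P' t * (f w - f d - f' d * (w - d)) \<le> \<theta> * (f w - f d)\<^sup>2"
proof -
  let ?e = "esssup lebesgue (\<lambda>t. ereal \<bar>P' t\<bar>)"
  have AE_e: "AE t in lebesgue. ereal \<bar>P' t\<bar> \<le> ?e" by (rule esssup_AE)
  obtain N where N: "negligible N" "\<And>t. t \<notin> N \<Longrightarrow> ereal \<bar>P' t\<bar> \<le> ?e"
    using AE_lebesgue_imp_negligible[OF AE_e] by blast
  \<comment> \<open>One point outside the null set bounds the essential supremum below by 0; the
    strict hypothesis makes it finite.\<close>
  have "N \<noteq> UNIV" using N(1) non_negligible_UNIV by auto
  then obtain t0 where "t0 \<notin> N" by auto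
  then have "ereal \<bar>P' t0\<bar> \<le> ?e" by (rule N(2))
  then have "0 \<le> ?e" using order_trans[of 0 "ereal \<bar>P' t0\<bar>"] by simp
  moreover have "?e \<noteq> \<infinity>" using less by auto
  ultimately obtain M where M: "?e = ereal M" "M \<ge> 0" by (cases ?e) auto
  obtain m where m: "2 * ?e < ereal m" "ereal m <
      (INF (w, d) \<in> {(w, d). w \<in> I \<and> d \<in> D \<and> \<bar>f w - f d - (w - d) * f' d\<bar> \<noteq> 0}.
         ereal ((f w - f d)\<^sup>2 / \<bar>f w - f d - (w - d) * f' d\<bar>))"
    using ereal_dense2[OF less] by blast
  have mM: "2 * M < m" using m(1) M by simp
  \<comment> \<open>Pairs with vanishing denominator are left out of the infimum, but for them the
    left side is 0.\<close>
  have R: "m * \<bar>f w - f d - f' d * (w - d)\<bar> \<le> (f w - f d)\<^sup>2" if wd: "w \<in> I" "d \<in> D" for w d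
  proof (cases "f w - f d - (w - d) * f' d = 0")
    case True
    then show ?thesis by (simp add: mult.commute)
  next
    case False
    have "ereal m < ereal ((f w - f d)\<^sup>2 / \<bar>f w - f d - (w - d) * f' d\<bar>)"
      by (rule less_le_trans[OF m(2) INF_lower2[of "(w, d)"]]) (use wd False in auto)
    then have "m < (f w - f d)\<^sup>2 / \<bar>f w - f d - (w - d) * f' d\<bar>" by simp
    then have "m * \<bar>f w - f d - (w - d) * f' d\<bar> < (f w - f d)\<^sup>2"
      using False by (simp add: pos_less_divide_eq)
    then show ?thesis by (simp add: mult.commute)
  qed
  have "2 * P' t * (f w - f d - f' d * (w - d)) \<le> (2 * M / m) * (f w - f d)\<^sup>2"
    if t: "t \<notin> N" and wd: "w \<in> I" "d \<in> D" for t w d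
  proof -
    let ?R = "f w - f d - f' d * (w - d)"
    have "\<bar>P' t\<bar> \<le> M" using N(2)[OF t] M by simp
    then have "2 * \<bar>P' t\<bar> * \<bar>?R\<bar> \<le> 2 * M * \<bar>?R\<bar>" by (intro mult_right_mono) auto
    moreover have "2 * P' t * ?R \<le> \<bar>2 * P' t * ?R\<bar>" by (rule abs_ge_self)
    moreover have "2 * M * \<bar>?R\<bar> = (2 * M / m) * (m * \<bar>?R\<bar>)" using mM M by simp
    moreover have "(2 * M / m) * (m * \<bar>?R\<bar>) \<le> (2 * M / m) * (f w - f d)\<^sup>2"
      using R[OF wd] mM M by (intro mult_left_mono) auto
    ultimately show ?thesis by (simp add: abs_mult)
  qed
  then have "AE t in lebesgue. \<forall>w\<in>I. \<forall>d\<in>D. 2 * P' t * (f w - f d - f' d * (w - d)) \<le> (2 * M / m) * (f w - f d)\<^sup>2"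
    using N(1) by (intro AE_I'[of N]) (auto simp: negligible_iff_null_sets)
  moreover have "2 * M / m < 1" using mM M by simp
  ultimately show ?thesis using that by blast
qed

section \<open>Decay of \<open>y - P\<close>\<close>

theorem proposition1:
  fixes c T :: real and f s y0 y y' P P' :: "real \<Rightarrow> real" and I :: "real set"
  assumes c: "c \<in> {-1, 1}"
    and f: "C2_fun f" "\<And>x. deriv f x > 0" "f 0 = 0"
    and s: "T > 0" "\<And>t. s (t + T) = s t"
    and y0: "H1_on {-1<..<0} y0"
    and y: "H1_loc_on {-1<..} y" "continuous_on {-1<..} y" "has_weak_deriv_on {-1<..} y y'"
    and y_eq: "neutral_eq_on {0<..} c f s y y'"
    and y_init: "\<And>t. -1 < t \<Longrightarrow> t < 0 \<Longrightarrow> y t = y0 t" "(y0 \<longlongrightarrow> y (-1)) (at_right (-1))"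
    and P: "H1_loc_on UNIV P" "continuous_on UNIV P" "has_weak_deriv_on UNIV P P'"
    and P_eq: "neutral_eq_on UNIV c f s P P'"
    and P_periodic: "\<exists>\<tau>>0. \<forall>t. P (t + \<tau>) = P t"
    and I: "I = convex hull (y ` {-1..} \<union> range P)" "bounded I"
    and less: "2 * esssup lebesgue (\<lambda>t. ereal \<bar>P' t\<bar>) <
      (INF (w, d) \<in> {(w, d). w \<in> I \<and> d \<in> range P \<and> \<bar>f w - f d - (w - d) * deriv f d\<bar> \<noteq> 0}.
         ereal ((f w - f d)\<^sup>2 / \<bar>f w - f d - (w - d) * deriv f d\<bar>))"
  shows "((\<lambda>t. y t - P t) \<longlongrightarrow> 0) at_top"
proof -
  have f': "(f has_real_derivative deriv f x) (at x)" for x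
    using f(1) unfolding C2_fun_def by (simp add: DERIV_deriv_iff_real_differentiable)
  have f'': "(deriv f has_real_derivative deriv (deriv f) x) (at x)" for x
    using f(1) unfolding C2_fun_def by (simp add: DERIV_deriv_iff_real_differentiable)
  have f''_cont: "continuous_on UNIV (deriv (deriv f))"
    using f(1) unfolding C2_fun_def by simp
  obtain \<Phi> where \<Phi>: "\<And>x. (\<Phi> has_real_derivative f x) (at x)"
    using continuous_antiderivative_exists[OF DERIV_isCont[OF f']] by blast
  have mono: "f p \<le> f q" if "p \<le> q" for p q
    using that f' f(2) by (meson DERIV_nonneg_imp_nondecreasing less_imp_le)

  have y_I: "y t \<in> I" if "t \<ge> 0" for t
    unfolding I(1) by (rule hull_inc) (use that in auto)
  have P_I: "P t \<in> I" for t
    unfolding I(1) by (rule hull_inc) auto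
  obtain B where B: "\<And>w. w \<in> I \<Longrightarrow> \<bar>w\<bar> \<le> B"
    using I(2) unfolding bounded_iff by auto
  have "0 \<le> B" using B[OF P_I[of 0]] by linarith
  moreover have "continuous_on {-B..B} (deriv f)"
    by (simp add: continuous_at_imp_continuous_on DERIV_isCont[OF f''])
  ultimately obtain x0 where x0: "\<And>x. x \<in> {-B..B} \<Longrightarrow> deriv f x0 \<le> deriv f x"
    using continuous_attains_inf[of "{-B..B}" "deriv f"] by force
  \<comment> \<open>Boundedness of \<open>I\<close> enters here: the minimum of
    \<open>deriv f\<close> over \<open>{-B..B}\<close> is attained, hence positive, and gives
    \<open>\<bar>g\<bar> \<ge> \<kappa> * \<bar>y - P\<bar>\<close>.\<close>
  define \<kappa> where "\<kappa> = deriv f x0"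
  have \<kappa>: "\<kappa> > 0" unfolding \<kappa>_def by (rule f(2))

  define v where "v = (\<lambda>r. y' r - P' r)"
  define g where "g = (\<lambda>r. f (y r) - f (P r))"
  define G where "G = (\<lambda>r. \<Phi> (y r) - \<Phi> (P r) - f (P r) * (y r - P r))"

  have g_ge: "\<kappa>\<^sup>2 * (y t - P t)\<^sup>2 \<le> (g t)\<^sup>2" if t: "t \<ge> 0" for t
  proof -
    obtain \<xi> where \<xi>: "min (P t) (y t) \<le> \<xi>" "\<xi> \<le> max (P t) (y t)" "f (y t) - f (P t) = deriv f \<xi> * (y t - P t)"
      using MVT_segment[OF f'] by blast
    have "\<kappa> \<le> deriv f \<xi>"
      unfolding \<kappa>_def using \<xi>(1,2) B[OF P_I[of t]] B[OF y_I[OF t]] by (intro x0) auto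
    then have "\<kappa>\<^sup>2 \<le> (deriv f \<xi>)\<^sup>2" using \<kappa> by (intro power_mono) auto
    then show ?thesis unfolding g_def \<xi>(3) power_mult_distrib by (rule mult_right_mono) simp
  qed
  have G_nonneg: "0 \<le> G t" for t
  proof -
    obtain \<xi> where \<xi>: "min (P t) (y t) \<le> \<xi>" "\<xi> \<le> max (P t) (y t)" "\<Phi> (y t) - \<Phi> (P t) = f \<xi> * (y t - P t)"
      using MVT_segment[OF \<Phi>] by blast
    \<comment> \<open>By monotonicity \<open>f \<xi> - f (P t)\<close> has the same sign as
      \<open>y t - P t\<close>, since \<open>\<xi>\<close> lies between \<open>P t\<close> and
      \<open>y t\<close>.\<close>
    have "0 \<le> (f \<xi> - f (P t)) * (y t - P t)"
    proof (cases "P t \<le> y t")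
      case True
      then show ?thesis using mono[of "P t" \<xi>] \<xi> by (intro mult_nonneg_nonneg) auto
    next
      case False
      then show ?thesis using mono[of \<xi> "P t"] \<xi> by (intro mult_nonpos_nonpos) auto
    qed
    then show ?thesis unfolding G_def \<xi>(3) by (simp add: algebra_simps)
  qed

  have y_H1: "H1_primitive a b y y'" if "a > -1" for a b
    by (rule H1_loc_on_imp_H1_primitive[OF _ _ y]) (use that in auto)
  have P_H1: "H1_primitive a b P P'" for a b
    by (rule H1_loc_on_imp_H1_primitive[OF _ _ P]) auto
  have z_H1: "H1_primitive a b (\<lambda>t. y t - P t) v" if "a > -1" for a b
    unfolding v_def by (intro H1_primitive_diff y_H1 P_H1 that)

  \<comment> \<open>The window at time 0 reaches back to -1, where the local regularity of
    \<open>y\<close> ends; on \<open>{-1..0}\<close> the initial datum provides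
    integrability.\<close>
  have v_sq: "(\<lambda>r. (v r)\<^sup>2) integrable_on {-1..t}" if "t \<ge> 0" for t
  proof (rule Henstock_Kurzweil_Integration.integrable_combine[of "-1" 0 t])
    have y'_int: "y' integrable_on {-1..0}" "(\<lambda>r. (y' r)\<^sup>2) integrable_on {-1..0}"
      by (rule H1_on_Ioo_imp_weak_deriv_integrable[OF y0 _ _ y(2,3)]; use y_init(1) in force)+
    note P'_int = H1_primitive_integrable[OF P_H1 order_refl, of "-1" 0]
    have "(\<lambda>r. (y' r)\<^sup>2 - 2 * (y' r * P' r) + (P' r)\<^sup>2) integrable_on {-1..0}"
      by (intro Henstock_Kurzweil_Integration.integrable_add Henstock_Kurzweil_Integration.integrable_diff
          integrable_on_mult_right y'_int P'_int(4)
          set_lebesgue_integral_eq_integral(1)[OF square_integrable_mult[OF y'_int P'_int(2,4)]])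
    then show "(\<lambda>r. (v r)\<^sup>2) integrable_on {-1..0}"
      by (simp add: v_def power2_diff algebra_simps)
    show "(\<lambda>r. (v r)\<^sup>2) integrable_on {0..t}"
      using H1_primitive_integrable(4)[OF z_H1[of 0 t] order_refl] by simp
  qed (use that in auto)

  obtain \<theta> where \<theta>: "\<theta> < 1"
    "AE t in lebesgue. \<forall>w\<in>I. \<forall>d\<in>range P. 2 * P' t * (f w - f d - deriv f d * (w - d)) \<le> \<theta> * (f w - f d)\<^sup>2"
    using remainder_bound_of_less_INF[OF less] by blast
  have bound: "AE r in lebesgue. r > 0 \<longrightarrow> 2 * P' r * (g r - deriv f (P r) * (y r - P r)) \<le> \<theta> * (g r)\<^sup>2"
    using \<theta>(2) by eventually_elim (use y_I in \<open>auto simp: g_def\<close>)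
  have eq: "AE r in lebesgue. r > 0 \<longrightarrow> v r + c * v (r - 1) + g r = 0"
    using y_eq[unfolded neutral_eq_on_def] P_eq[unfolded neutral_eq_on_def]
    by eventually_elim (auto simp: v_def g_def algebra_simps)

  define E0 where "E0 = integral {-1..0} (\<lambda>r. (v r)\<^sup>2) + 2 * G 0"
  have energy: "integral {t-1..t} (\<lambda>r. (v r)\<^sup>2) + 2 * G t + (1 - \<theta>) * integral {0..t} (\<lambda>r. (g r)\<^sup>2) \<le> E0"
    if t: "t \<ge> 0" for t
    unfolding E0_def
    using neutral_energy_estimate[OF c t \<Phi> f' f'' f''_cont y_H1 P_H1 v_def v_sq[OF t] g_def G_def eq bound]
    by simp
  have g_int: "(\<lambda>r. (g r)\<^sup>2) integrable_on {0..t}" for t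
  proof -
    have f_cont: "continuous_on UNIV f"
      by (simp add: continuous_at_imp_continuous_on DERIV_isCont[OF f'])
    have "continuous_on {0..t} g"
      unfolding g_def
      by (intro continuous_on_diff continuous_on_compose2[OF f_cont _ subset_UNIV]
          H1_primitive_continuous[OF y_H1] H1_primitive_continuous[OF P_H1]) simp
    then show ?thesis
      by (intro integrable_continuous_real continuous_on_power)
  qed
  have z_int: "(\<lambda>r. (y r - P r)\<^sup>2) integrable_on {0..t}" for t
    by (intro integrable_continuous_real continuous_on_power H1_primitive_continuous[OF z_H1]) simp
  show ?thesis
  \<comment> \<open>The energy bound is used twice: its dissipation term bounds the integral of
    \<open>(y - P)^2\<close>, and its window term gives the Hoelder constant
    \<open>E0\<close>.\<close>
  proof (rule Barbalat_square_integrable)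
    show "(\<lambda>r. (y r - P r)\<^sup>2) integrable_on {0..t}" for t by (rule z_int)
    fix t :: real assume t: "t \<ge> 0"
    have "0 \<le> integral {t-1..t} (\<lambda>r. (v r)\<^sup>2)"
      using t by (intro Henstock_Kurzweil_Integration.integral_nonneg integrable_subinterval_real[OF v_sq[OF t]]) auto
    then have "(1 - \<theta>) * integral {0..t} (\<lambda>r. (g r)\<^sup>2) \<le> E0"
      using energy[OF t] G_nonneg[of t] by linarith
    then have "integral {0..t} (\<lambda>r. (g r)\<^sup>2) \<le> E0 / (1 - \<theta>)"
      using \<theta>(1) by (simp add: field_simps)
    moreover have "integral {0..t} (\<lambda>r. \<kappa>\<^sup>2 * (y r - P r)\<^sup>2) \<le> integral {0..t} (\<lambda>r. (g r)\<^sup>2)"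
      using g_ge by (intro Henstock_Kurzweil_Integration.integral_le integrable_on_mult_right z_int g_int) auto
    ultimately have "\<kappa>\<^sup>2 * integral {0..t} (\<lambda>r. (y r - P r)\<^sup>2) \<le> E0 / (1 - \<theta>)"
      by simp
    then show "integral {0..t} (\<lambda>r. (y r - P r)\<^sup>2) \<le> E0 / (1 - \<theta>) / \<kappa>\<^sup>2"
      using \<kappa> by (subst pos_le_divide_eq) (simp_all add: mult.commute)
  next
    fix s t :: real assume st: "0 \<le> s" "s \<le> t" "t \<le> s + 1"
    then have t: "t \<ge> 0" by simp
    have "((y t - P t) - (y s - P s))\<^sup>2 = (integral {s..t} v)\<^sup>2"
      using z_H1[of s t] st unfolding H1_primitive_def by auto
    also have "\<dots> \<le> (t - s) * integral {s..t} (\<lambda>r. (v r)\<^sup>2)"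
      using H1_primitive_integrable[OF z_H1[of s t] order_refl] st by (intro integral_squared_le) auto
    \<comment> \<open>From \<open>t \<le> s + 1\<close>, the interval \<open>{s..t}\<close> lies
      inside the energy window.\<close>
    also have "\<dots> \<le> (t - s) * integral {t-1..t} (\<lambda>r. (v r)\<^sup>2)"
      using st by (intro mult_left_mono Henstock_Kurzweil_Integration.integral_subset_le
          integrable_subinterval_real[OF v_sq[OF t]]) auto
    also have "\<dots> \<le> (t - s) * E0"
    proof (rule mult_left_mono)
      have "0 \<le> (1 - \<theta>) * integral {0..t} (\<lambda>r. (g r)\<^sup>2)"
        using \<theta>(1) by (intro mult_nonneg_nonneg Henstock_Kurzweil_Integration.integral_nonneg g_int) auto
      then show "integral {t-1..t} (\<lambda>r. (v r)\<^sup>2) \<le> E0"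
        using energy[OF t] G_nonneg[of t] by linarith
    qed (use st in auto)
    finally show "((y t - P t) - (y s - P s))\<^sup>2 \<le> (t - s) * E0" .
  qed
qed

end
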